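(* Let $l,n\ge 1$ and let $q\in\mathbb{C}$ not be a root of unity. Let $(P,Q)\in\mathcal{T}_l\times\mathcal{S}_n$ with $\mathrm{sh}\,P=\mathrm{sh}\,Q=\lambda$. Then $$\sum_{w\in[l]^n}\phi_w(P,Q)=(\lambda_l)_q^{-1}\,\kappa(P)\,\rho(Q).$$
   Context: Notation. $[l]=\{1,\dots,l\}$. For an integer $m\ge 0$, $(m)_q=(1-q)(1-q^2)\cdots(1-q^m)$, with $(0)_q=1$. $e_i$ denotes the $i$-th standard basis vector. Tableaux. A tableau with entries in $[l]$ is a Young diagram filled with elements of $[l]$, weakly increasing along rows and strictly increasing down columns. $\mathcal{T}_l$ is the set of such tableaux, including the empty one. $\mathcal{S}_n$ is the set of standard tableaux of size $n$, i.e. tableaux containing each of $1,\dots,n$ exactly once. $\mathrm{sh}\,P$ is the shape of $P$, a partition. The type $\mathrm{ty}\,P=(\mu_1,\dots,\mu_l)$ records in $\mu_i$ the number of entries equal to $i$. For $P\in\mathcal{T}_l$ and $0\le i\le l$, $P^i$ is the subtableau of entries $\le i$, and $\lambda^i=\mathrm{sh}\,P^i$ is a partition with at most $i$ parts; $\lambda^0=\emptyset$. We write $\lambda^i_j$ for the $j$-th part, with the convention $\lambda^i_j=0$ for $j>i$, for $j=0$, and beyond the length of the partition. For a partition $\lambda$, $\lambda_l$ is its $l$-th part, possibly $0$. q-insertion kernel. Let $k\in[l]$ and $P,\tilde P\in\mathcal{T}_l$, and write $\lambda^i=\mathrm{sh}\,P^i$ and $\tilde\lambda^i=\mathrm{sh}\,\tilde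 P^i$. Then $I_k(P,\tilde P)=0$ unless both of the following hold: - $\mathrm{ty}\,\tilde P=\mathrm{ty}\,P+e_k$; - there is a weakly decreasing sequence $k=j_{k-1}\ge j_k\ge\cdots\ge j_l\ge 1$ with $\tilde\lambda^i=\lambda^i$ for $i<k$ and $\tilde\lambda^i=\lambda^i+e_{j_i}$ for $k\le i\le l$. In that case define, for $j>1$, $$f_0(i,j)=1-q^{\lambda^{i-1}_{j-1}-\lambda^i_j},\qquad f_1(i,j)=\frac{1-q^{\lambda^{i-1}_{j-1}-\lambda^i_j}}{1-q^{\lambda^{i-1}_{j-1}-\lambda^{i-1}_j}},$$ and $f_0(i,1)=f_1(i,1)=1$. Set $f(i,j)=f_1(i,j)$ if $j=j_{i-1}$ and $i\neq k$, and $f(i,j)=f_0(i,j)$ otherwise. Then $$I_k(P,\tilde P)=\prod_{i=k}^{l}\Big(f(i,j_i)\prod_{j=j_i+1}^{j_{i-1}}(1-f(i,j))\Big).$$ Weights $\phi_w$. For a word $w\in[l]^n$, the function $\phi_w:\mathcal{T}_l\times\mathcal{S}_n\to\mathbb{C}$ is defined recursively. - For a one-letter word $k$: $\phi_k(P,Q)=1$ if $P$ is the one-box tableau with entry $k$ and $Q$ is the one-box tableau with entry $1$, and $\phi_k(P,Q)=0$ otherwise. - For $w\in[l]^n$, $k\in[l]$ and $(\tilde P,\tilde Q)\in\mathcal{T}_l\times\mathcal{S}_{n+1}$ with $\mathrm{sh}\,\tilde P=\mathrm{sh}\,\tilde Q$: $\phi_{wk}(\tilde P,\tilde Q)=\sum_{P}\phi_w(P,Q)\,I_k(P,\tilde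 P)$, where $Q$ is $\tilde Q$ with its entry $n+1$ removed, and the sum runs over $P\in\mathcal{T}_l$ with $\mathrm{sh}\,P=\mathrm{sh}\,Q$. If $\mathrm{sh}\,\tilde P\neq\mathrm{sh}\,\tilde Q$, then $\phi_{wk}(\tilde P,\tilde Q)=0$. The function $\kappa$. For $P\in\mathcal{T}_l$ with $\lambda^i=\mathrm{sh}\,P^i$, $$\kappa(P)=\frac{\prod_{j=2}^{l-1}\prod_{i=1}^{j-1}(\lambda^j_i-\lambda^j_{i+1})_q}{\prod_{j=1}^{l-1}\prod_{i=1}^{j}(\lambda^j_i-\lambda^{j+1}_{i+1})_q\,(\lambda^{j+1}_i-\lambda^j_i)_q}.$$ The function $\rho$. For $Q\in\mathcal{S}_n$ let $\mu^i=\mathrm{sh}\,Q^i$ for $0\le i\le n$, with $\mu^0=\emptyset$. Then $$\rho(Q)=\prod(1-q^{\mu^i_j-\mu^i_{j+1}}),$$ where the product is over all pairs $(i,j)$ with $1\le i\le n$ and $j\ge1$ such that $\mu^i_j-\mu^{i-1}_j=1$, i.e. $j$ is the row of the box containing $i$. *)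

theory Defs
  imports Complex_Main
begin

definition qfac :: "complex \<Rightarrow> nat \<Rightarrow> complex" where
  "qfac q m = (\<Prod>i=1..m. 1 - q ^ i)"

definition root_of_unity :: "complex \<Rightarrow> bool" where
  "root_of_unity z \<longleftrightarrow> (\<exists>m>0. z ^ m = 1)"


section \<open>Tableaux\<close>

text \<open>A tableau is the list of its rows, top row first. Empty rows are forbidden, so that every
  tableau has exactly one representation and the empty tableau is the empty list.\<close>

type_synonym tableau = "nat list list"

definition is_tableau :: "tableau \<Rightarrow> bool" where
  "is_tableau T \<longleftrightarrow>
     [] \<notin> set T \<and>
     sorted_wrt (\<ge>) (map length T) \<and>
     (\<forall>r\<in>set T. sorted r) \<and>
     (\<forall>i j. Suc i < length T \<longrightarrow> j < length (T ! Suc i) \<longrightarrow> T ! i ! j < T ! Suc i ! j)"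

definition tableaux :: "nat \<Rightarrow> tableau set" where
  "tableaux l = {T. is_tableau T \<and> set (concat T) \<subseteq> {1..l}}"

definition standard_tableaux :: "nat \<Rightarrow> tableau set" where
  "standard_tableaux n = {T. is_tableau T \<and> set (concat T) = {1..n} \<and> distinct (concat T)}"

text \<open>Partitions are functions from the 1-based index of a part to the part, extended by zero
  (at index 0 as well).\<close>

definition sh :: "tableau \<Rightarrow> nat \<Rightarrow> nat" where
  "sh T j = (if 1 \<le> j \<and> j \<le> length T then length (T ! (j - 1)) else 0)"

definition ty :: "tableau \<Rightarrow> nat \<Rightarrow> nat" where
  "ty T i = count_list (concat T) i"

definition add_unit :: "(nat \<Rightarrow> nat) \<Rightarrow> nat \<Rightarrow> nat \<Rightarrow> nat" where
  "add_unit a k = a(k := a k + 1)"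

text \<open>The subtableau \<open>P\<^sup>i\<close> of the entries at most \<open>i\<close>, and its shape \<open>\<lambda>\<^sup>i\<close>.\<close>

definition subtab :: "nat \<Rightarrow> tableau \<Rightarrow> tableau" where
  "subtab i T = filter (\<lambda>r. r \<noteq> []) (map (filter (\<lambda>x. x \<le> i)) T)"

definition subsh :: "tableau \<Rightarrow> nat \<Rightarrow> nat \<Rightarrow> nat" where
  "subsh T i = sh (subtab i T)"


section \<open>The q-insertion kernel\<close>

text \<open>\<open>is_path l k P P' J\<close> says that \<open>J (k - 1), \<dots>, J l\<close> is a weakly decreasing sequence as
  in the definition of the kernel; the values of \<open>J\<close> outside \<open>{k - 1..l}\<close> are irrelevant.\<close>

definition is_path :: "nat \<Rightarrow> nat \<Rightarrow> tableau \<Rightarrow> tableau \<Rightarrow> (nat \<Rightarrow> nat) \<Rightarrow> bool" where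
  "is_path l k P P' J \<longleftrightarrow>
     J (k - 1) = k \<and>
     (\<forall>i\<in>{k..l}. 1 \<le> J i \<and> J i \<le> J (i - 1)) \<and>
     (\<forall>i<k. subsh P' i = subsh P i) \<and>
     (\<forall>i\<in>{k..l}. subsh P' i = add_unit (subsh P i) (J i))"

text \<open>In all exponents below, subtraction of naturals never truncates: \<open>\<lambda>\<^sup>i\<close> is weakly decreasing
  and consecutive shapes interlace, that is
  \<open>\<lambda>\<^sup>i\<^sub>j \<ge> \<lambda>\<^sup>i\<^sup>-\<^sup>1\<^sub>j \<ge> \<lambda>\<^sup>i\<^sub>j\<^sub>+\<^sub>1\<close> for \<open>j \<ge> 1\<close>.\<close>

definition f0 :: "complex \<Rightarrow> tableau \<Rightarrow> nat \<Rightarrow> nat \<Rightarrow> complex" where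
  "f0 q P i j =
     (if j = 1 then 1 else 1 - q ^ (subsh P (i - 1) (j - 1) - subsh P i j))"

definition f1 :: "complex \<Rightarrow> tableau \<Rightarrow> nat \<Rightarrow> nat \<Rightarrow> complex" where
  "f1 q P i j =
     (if j = 1 then 1
      else (1 - q ^ (subsh P (i - 1) (j - 1) - subsh P i j)) /
           (1 - q ^ (subsh P (i - 1) (j - 1) - subsh P (i - 1) j)))"

definition ff :: "complex \<Rightarrow> nat \<Rightarrow> tableau \<Rightarrow> (nat \<Rightarrow> nat) \<Rightarrow> nat \<Rightarrow> nat \<Rightarrow> complex" where
  "ff q k P J i j = (if j = J (i - 1) \<and> i \<noteq> k then f1 q P i j else f0 q P i j)"

definition path_weight :: "complex \<Rightarrow> nat \<Rightarrow> nat \<Rightarrow> tableau \<Rightarrow> (nat \<Rightarrow> nat) \<Rightarrow> complex" where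
  "path_weight q l k P J =
     (\<Prod>i=k..l. ff q k P J i (J i) * (\<Prod>j=J i + 1..J (i - 1). 1 - ff q k P J i j))"

text \<open>The choice of the path is immaterial, see \<open>kernel_eq\<close> below.\<close>

definition kernel :: "complex \<Rightarrow> nat \<Rightarrow> nat \<Rightarrow> tableau \<Rightarrow> tableau \<Rightarrow> complex" where
  "kernel q l k P P' =
     (if ty P' = add_unit (ty P) k \<and> (\<exists>J. is_path l k P P' J)
      then path_weight q l k P (SOME J. is_path l k P P' J)
      else 0)"

lemma add_unit_inject: "add_unit a i = add_unit a j \<Longrightarrow> i = j"
  by (metis add_unit_def fun_upd_apply n_not_Suc_n Suc_eq_plus1)

lemma is_path_unique:
  assumes "is_path l k P P' J" "is_path l k P P' J'" "i = k - 1 \<or> i \<in> {k..l}"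
  shows "J i = J' i"
  using assms unfolding is_path_def by (metis add_unit_inject)

lemma path_weight_cong:
  assumes "\<And>i. i = k - 1 \<or> i \<in> {k..l} \<Longrightarrow> J i = J' i"
  shows "path_weight q l k P J = path_weight q l k P J'"
  unfolding path_weight_def
proof (rule prod.cong[OF refl])
  fix i assume i: "i \<in> {k..l}"
  have "J i = J' i" using assms i by blast
  moreover have "i - 1 = k - 1 \<or> i - 1 \<in> {k..l}" using i by (cases "i = k") auto
  then have "J (i - 1) = J' (i - 1)" using assms by blast
  ultimately show "ff q k P J i (J i) * (\<Prod>j=J i + 1..J (i - 1). 1 - ff q k P J i j) =
      ff q k P J' i (J' i) * (\<Prod>j=J' i + 1..J' (i - 1). 1 - ff q k P J' i j)"
    by (simp add: ff_def)
qed

lemma kernel_eq: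
  assumes "ty P' = add_unit (ty P) k" "is_path l k P P' J"
  shows "kernel q l k P P' = path_weight q l k P J"
proof -
  have "is_path l k P P' (SOME J. is_path l k P P' J)"
    using assms(2) by (rule someI[where P = "is_path l k P P'"])
  then have "path_weight q l k P (SOME J. is_path l k P P' J) = path_weight q l k P J"
    by (intro path_weight_cong is_path_unique[OF _ assms(2)])
  then show ?thesis using assms unfolding kernel_def by auto
qed


section \<open>The weights of a word\<close>

text \<open>\<open>phi_rev\<close> takes the word reversed, so that its last letter is split off first; the empty word
  carries no meaning. In the recursive case the length of the word without its last letter \<open>k\<close> is
  \<open>Suc (length w)\<close>, and \<open>subtab\<close> removes from \<open>Q'\<close> its largest entry.\<close>

fun phi_rev :: "complex \<Rightarrow> nat \<Rightarrow> nat list \<Rightarrow> tableau \<Rightarrow> tableau \<Rightarrow> complex" where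
  "phi_rev q l [] P Q = 0"
| "phi_rev q l [k] P Q = (if P = [[k]] \<and> Q = [[1]] then 1 else 0)"
| "phi_rev q l (k # k' # w) P' Q' =
     (if sh P' = sh Q'
      then let Q = subtab (Suc (length w)) Q'
           in \<Sum>P | P \<in> tableaux l \<and> sh P = sh Q. phi_rev q l (k' # w) P Q * kernel q l k P P'
      else 0)"

definition phi :: "complex \<Rightarrow> nat \<Rightarrow> nat list \<Rightarrow> tableau \<Rightarrow> tableau \<Rightarrow> complex" where
  "phi q l w = phi_rev q l (rev w)"

lemma phi_single: "phi q l [k] P Q = (if P = [[k]] \<and> Q = [[1]] then 1 else 0)"
  by (simp add: phi_def)

lemma phi_snoc:
  assumes "w \<noteq> []"
  shows "phi q l (w @ [k]) P' Q' =
    (if sh P' = sh Q'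
     then \<Sum>P | P \<in> tableaux l \<and> sh P = sh (subtab (length w) Q').
            phi q l w P (subtab (length w) Q') * kernel q l k P P'
     else 0)"
proof -
  obtain k' v where v: "rev w = k' # v"
    using assms by (cases "rev w") auto
  then have "length w = Suc (length v)"
    by (metis length_Cons length_rev)
  with v show ?thesis by (simp add: phi_def Let_def)
qed

text \<open>The sum ranges over a finite set, so it is a genuine sum.\<close>

lemma sh_eq_imp_lengths:
  assumes "is_tableau P" "is_tableau R" "sh P = sh R"
  shows "map length P = map length R"
proof -
  have *: "length A \<le> length B" if "is_tableau A" "sh A = sh B" for A B
  proof (rule ccontr)
    assume "\<not> length A \<le> length B"
    then have "sh A (length A) = 0" "A \<noteq> []"
      using that(2) by (auto simp: sh_def)
    then have "last A = []" by (simp add: sh_def last_conv_nth Suc_le_eq)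
    then show False using that(1) \<open>A \<noteq> []\<close> unfolding is_tableau_def by (metis last_in_set)
  qed
  have len: "length P = length R"
    using *[of P R] *[of R P] assms by simp
  have "length (P ! i) = length (R ! i)" if "i < length P" for i
    using fun_cong[OF assms(3), of "Suc i"] that len by (simp add: sh_def)
  then show ?thesis using len by (simp add: list_eq_iff_nth_eq)
qed

lemma finite_tableaux_shape: "finite {P. P \<in> tableaux l \<and> sh P = s}"
proof (cases "\<exists>R \<in> tableaux l. sh R = s")
  case True
  then obtain R where R: "R \<in> tableaux l" "sh R = s" by blast
  let ?n = "sum_list (map length R)"
  have "{P. P \<in> tableaux l \<and> sh P = s} \<subseteq>
      {P. set P \<subseteq> {r. set r \<subseteq> {1..l} \<and> length r \<le> ?n} \<and> length P = length R}"
  proof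
    fix P assume "P \<in> {P. P \<in> tableaux l \<and> sh P = s}"
    then have P: "P \<in> tableaux l" "map length P = map length R"
      using R sh_eq_imp_lengths[of P R] by (auto simp: tableaux_def)
    have "length r \<le> ?n" if "r \<in> set P" for r
    proof -
      have "length r \<in> set (map length P)" using that by simp
      then show ?thesis unfolding P(2) by (rule member_le_sum_list) simp
    qed
    moreover have "length P = length R" using P(2) by (metis length_map)
    ultimately show "P \<in> {P. set P \<subseteq> {r. set r \<subseteq> {1..l} \<and> length r \<le> ?n} \<and> length P = length R}"
      using P(1) by (fastforce simp: tableaux_def)
  qed
  then show ?thesis
    by (rule finite_subset) (intro finite_lists_length_eq finite_lists_length_le finite_atLeastAtMost)
next
  case False
  then have "{P. P \<in> tableaux l \<and> sh P = s} = {}" by blast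
  then show ?thesis by (simp only: finite.emptyI)
qed


section \<open>The functions \<open>\<kappa>\<close> and \<open>\<rho>\<close>\<close>

definition kappa :: "complex \<Rightarrow> nat \<Rightarrow> tableau \<Rightarrow> complex" where
  "kappa q l P =
     (\<Prod>j=2..l-1. \<Prod>i=1..j-1. qfac q (subsh P j i - subsh P j (i + 1))) /
     (\<Prod>j=1..l-1. \<Prod>i=1..j. qfac q (subsh P j i - subsh P (j + 1) (i + 1)) *
                            qfac q (subsh P (j + 1) i - subsh P j i))"

definition rho :: "complex \<Rightarrow> nat \<Rightarrow> tableau \<Rightarrow> complex" where
  "rho q n Q =
     (\<Prod>(i, j) \<in> {(i, j). 1 \<le> i \<and> i \<le> n \<and> 1 \<le> j \<and> subsh Q i j = subsh Q (i - 1) j + 1}.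
        1 - q ^ (subsh Q i j - subsh Q i (j + 1)))"

lemma finite_rho_index:
  "finite {(i, j). 1 \<le> i \<and> i \<le> n \<and> 1 \<le> j \<and> subsh Q i j = subsh Q (i - 1) j + 1}"
proof -
  have "j \<le> length Q" if "subsh Q i j = subsh Q (i - 1) j + 1" for i j
  proof -
    have "j \<le> length (subtab i Q)"
      using that by (auto simp: subsh_def sh_def split: if_splits)
    also have "\<dots> \<le> length Q"
      unfolding subtab_def by (metis length_filter_le length_map)
    finally show ?thesis .
  qed
  then have "{(i, j). 1 \<le> i \<and> i \<le> n \<and> 1 \<le> j \<and> subsh Q i j = subsh Q (i - 1) j + 1}
      \<subseteq> {1..n} \<times> {1..length Q}"
    by auto
  then show ?thesis by (rule finite_subset) simp
qed

end

theory Submission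
  imports Defs
begin

text \<open>By induction on \<open>n\<close>, removing the last letter of the word, the theorem reduces to an identity for
  one insertion step: summing \<open>\<kappa>(P) I\<^sub>k(P, P')\<close> over \<open>k\<close> and all \<open>P\<close> whose shape is that of \<open>P'\<close> minus a box
  in row \<open>j\<close> gives \<open>\<kappa>(P')\<close> times an explicit factor. A tableau is the same as the interlacing
  sequence of its shapes \<open>\<lambda>\<^sup>i\<close>, and both \<open>\<kappa>\<close> and the kernel are products over consecutive shapes, so
  this identity follows by induction on \<open>l\<close>, summing first over the row \<open>m = j\<^sub>l\<^sub>-\<^sub>1 \<ge> j\<close> of the box removed
  from \<open>a = \<lambda>\<^sup>l\<^sup>-\<^sup>1\<close>. With \<open>b = \<lambda>\<^sup>l\<close> and \<open>x\<^sub>i = q\<^bsup>a\<^sub>i - b\<^sub>i\<^sub>+\<^sub>1\<^esup>\<close> the term for \<open>m > j\<close> is, up to a common factor,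
  \<open>(1 - q\<^bsup>b\<^sub>j - a\<^sub>j\<^esup>) (1 - x\<^sub>m) x\<^sub>j \<cdots> x\<^sub>m\<^sub>-\<^sub>1\<close>, and the sum telescopes.\<close>


section \<open>q-factorials\<close>

lemma one_minus_power_neq_0:
  assumes "\<not> root_of_unity q" "m > 0"
  shows "1 - q ^ m \<noteq> 0"
  using assms unfolding root_of_unity_def by (metis right_minus_eq)

lemma qfac_Suc: "qfac q (Suc m) = qfac q m * (1 - q ^ Suc m)"
  by (simp add: qfac_def)

lemma qfac_neq_0: "\<not> root_of_unity q \<Longrightarrow> qfac q m \<noteq> 0"
  using one_minus_power_neq_0[of q] by (auto simp: qfac_def)

text \<open>Arguments that differ by one at a single index change one q-factorial by one factor. The
  \<open>of_bool\<close> form avoids truncated differences, and an index \<open>u\<close> or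
  \<open>v\<close> outside \<open>A\<close> stands for no change on that side.\<close>

lemma prod_qfac_shift:
  assumes "finite A"
    and "\<And>i. i \<in> A \<Longrightarrow> f i + of_bool (i = u) = g i + of_bool (i = v)"
  shows "(\<Prod>i\<in>A. qfac q (f i)) * (if u \<in> A then 1 - q ^ Suc (f u) else 1) =
         (\<Prod>i\<in>A. qfac q (g i)) * (if v \<in> A then 1 - q ^ Suc (g v) else 1)"
proof -
  have "(\<Prod>i\<in>A. qfac q (f i) * (if i = u then 1 - q ^ Suc (f u) else 1)) =
        (\<Prod>i\<in>A. qfac q (g i) * (if i = v then 1 - q ^ Suc (g v) else 1))"
  proof (rule prod.cong[OF refl])
    fix i assume "i \<in> A"
    from assms(2)[OF this]
    show "qfac q (f i) * (if i = u then 1 - q ^ Suc (f u) else 1) =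
          qfac q (g i) * (if i = v then 1 - q ^ Suc (g v) else 1)"
      by (auto simp del: power_Suc simp flip: qfac_Suc split: if_splits)
  qed
  then show ?thesis
    using assms(1) by (simp add: prod.distrib prod.delta del: power_Suc)
qed


section \<open>The identity for two consecutive shapes\<close>

text \<open>The second inequality starts at j = 1: at index 0, where parts are zero by convention,
  it would force \<open>b 1 = 0\<close>.\<close>

definition interlaces :: "(nat \<Rightarrow> nat) \<Rightarrow> (nat \<Rightarrow> nat) \<Rightarrow> bool" where
  "interlaces a b \<longleftrightarrow> a 0 = 0 \<and> b 0 = 0 \<and> (\<forall>j. a j \<le> b j) \<and> (\<forall>j\<ge>1. b (Suc j) \<le> a j)"

text \<open>The quotient of \<open>\<kappa>\<close> for patterns with \<open>L + 1\<close> and with \<open>L\<close> shapes, where \<open>a = \<lambda>\<^sup>L\<close> and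
  \<open>b = \<lambda>\<^sup>L\<^sup>+\<^sup>1\<close>.\<close>

definition kappa_step :: "complex \<Rightarrow> nat \<Rightarrow> (nat \<Rightarrow> nat) \<Rightarrow> (nat \<Rightarrow> nat) \<Rightarrow> complex" where
  "kappa_step q L a b =
     (\<Prod>i=1..L-1. qfac q (a i - a (i + 1))) /
     (\<Prod>i=1..L. qfac q (a i - b (i + 1)) * qfac q (b i - a i))"

text \<open>The function \<open>ff\<close> in terms of two consecutive shapes, so that the one-level
  identity can be treated for arbitrary interlacing pairs.\<close>

definition bump_factor ::
    "complex \<Rightarrow> (nat \<Rightarrow> nat) \<Rightarrow> (nat \<Rightarrow> nat) \<Rightarrow> bool \<Rightarrow> nat \<Rightarrow> nat \<Rightarrow> complex" where
  "bump_factor q a b bumped m j =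
     (if j = 1 then 1
      else if j = m \<and> bumped then (1 - q ^ (a (j - 1) - b j)) / (1 - q ^ (a (j - 1) - a j))
      else 1 - q ^ (a (j - 1) - b j))"

text \<open>The contribution of level \<open>i\<close> to the weight of a path, where \<open>a = \<lambda>\<^sup>i\<^sup>-\<^sup>1\<close>, \<open>b = \<lambda>\<^sup>i\<close>, \<open>m = j\<^sub>i\<^sub>-\<^sub>1\<close> and
  \<open>j = j\<^sub>i\<close>; \<open>bumped\<close> is false at the level \<open>i = k\<close> at which the path starts.\<close>

definition bump_weight ::
    "complex \<Rightarrow> (nat \<Rightarrow> nat) \<Rightarrow> (nat \<Rightarrow> nat) \<Rightarrow> bool \<Rightarrow> nat \<Rightarrow> nat \<Rightarrow> complex" where
  "bump_weight q a b bumped m j =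
     bump_factor q a b bumped m j * (\<Prod>i=j+1..m. 1 - bump_factor q a b bumped m i)"

text \<open>What the last row contributes is cancelled by \<open>(\<lambda>\<^sub>l)\<^sub>q\<close> in the theorem, hence the factor 1 there.\<close>

definition box_factor :: "complex \<Rightarrow> nat \<Rightarrow> (nat \<Rightarrow> nat) \<Rightarrow> nat \<Rightarrow> complex" where
  "box_factor q L a m = (if m < L then 1 - q ^ (a m - a (m + 1)) else 1)"

section \<open>Removing a box from each of two interlacing shapes\<close>

lemma interlaces_decreasing:
  "interlaces a b \<Longrightarrow> 1 \<le> j \<Longrightarrow> a (Suc j) \<le> a j"
  "interlaces a b \<Longrightarrow> 1 \<le> j \<Longrightarrow> b (Suc j) \<le> b j"
  unfolding interlaces_def by (meson order_trans)+

text \<open>Removing the two boxes can only violate the inequality between \<open>b (m + 1)\<close>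
  and \<open>a m\<close> and the one between \<open>a j\<close> and \<open>b j\<close>; for m = j
  the latter survives because both sides drop by one.\<close>

lemma interlaces_remove_iff:
  assumes ab: "interlaces a b" and b: "b = add_unit s j" and j: "1 \<le> j" "j \<le> m"
    and am: "a = add_unit t m"
  shows "interlaces t s \<longleftrightarrow> b (m + 1) < a m \<and> (m = j \<or> a j < b j)"
proof
  assume "interlaces t s"
  then have "s (Suc m) \<le> t m" "t j \<le> s j"
    using j by (auto simp: interlaces_def)
  then show "b (m + 1) < a m \<and> (m = j \<or> a j < b j)"
    using j b am by (auto simp: add_unit_def)
next
  assume *: "b (m + 1) < a m \<and> (m = j \<or> a j < b j)"
  have 1: "a i \<le> b i" "1 \<le> i \<Longrightarrow> b (Suc i) \<le> a i" "a 0 = 0" "b 0 = 0" for i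
    using ab by (auto simp: interlaces_def)
  have "t i \<le> s i" for i
    using * 1(1)[of i] b am by (auto simp: add_unit_def split: if_splits)
  moreover have "s (Suc i) \<le> t i" if "1 \<le> i" for i
    using * 1(2)[OF that] b am j by (auto simp: add_unit_def split: if_splits)
  ultimately show "interlaces t s"
    using 1(3,4) b am j by (auto simp: interlaces_def add_unit_def split: if_splits)
qed

text \<open>The variant for a path that starts at this level, where no box leaves
  \<open>a\<close>.\<close>

lemma interlaces_remove_iff':
  assumes ab: "interlaces a b" and b: "b = add_unit s j" and j: "1 \<le> j"
  shows "interlaces a s \<longleftrightarrow> a j < b j"
proof
  assume "interlaces a s"
  then have "a j \<le> s j" by (auto simp: interlaces_def)
  then show "a j < b j" using b by (auto simp: add_unit_def)
next
  assume *: "a j < b j"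
  have 1: "a i \<le> b i" "1 \<le> i \<Longrightarrow> b (Suc i) \<le> a i" "a 0 = 0" "b 0 = 0" for i
    using ab by (auto simp: interlaces_def)
  have "a i \<le> s i" for i
    using * 1(1)[of i] b by (auto simp: add_unit_def split: if_splits)
  moreover have "s (Suc i) \<le> a i" if "1 \<le> i" for i
    using * 1(2)[OF that] b j by (auto simp: add_unit_def split: if_splits)
  ultimately show "interlaces a s"
    using 1(3,4) b j by (auto simp: interlaces_def add_unit_def split: if_splits)
qed

text \<open>Only the denominator factors with indices j - 1 and j change. The first change cancels
  against the bump factor in row \<open>j\<close>, the second yields
  \<open>1 - q ^ (b j - a j)\<close> for j \<le> L, and each of the rows j + 1 to L + 1 contributes
  a pure power of q.\<close>

lemma kappa_step_remove_start:
  assumes q: "\<not> root_of_unity q" and ab: "interlaces a b" and b: "b = add_unit s j"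
    and j: "1 \<le> j" "j \<le> Suc L" and lt: "a j < b j"
  shows "kappa_step q L a s * bump_weight q a s False (Suc L) j =
         (if j \<le> L then (1 - q ^ (b j - a j)) * (\<Prod>i=j..L. q ^ (a i - b (i + 1))) else 1)
         * kappa_step q L a b"
proof -
  have 1: "a i \<le> b i" "1 \<le> i \<Longrightarrow> b (Suc i) \<le> a i" for i
    using ab by (auto simp: interlaces_def)
  have s: "b j = Suc (s j)" "\<And>i. i \<noteq> j \<Longrightarrow> b i = s i"
    using b by (auto simp: add_unit_def)
  define p where "p = (if j = 1 then 1 else 1 - q ^ (a (j - 1) - s j))"
  define y where "y = (if j \<le> L then 1 - q ^ (b j - a j) else 1)"
  define N where "N = (\<Prod>i=1..L-1. qfac q (a i - a (i + 1)))"
  define D1 D2 D1' D2' where "D1 = (\<Prod>i=1..L. qfac q (a i - b (i + 1)))"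
    and "D2 = (\<Prod>i=1..L. qfac q (b i - a i))"
    and "D1' = (\<Prod>i=1..L. qfac q (a i - s (i + 1)))"
    and "D2' = (\<Prod>i=1..L. qfac q (s i - a i))"
  have nz: "D1 \<noteq> 0" "D2 \<noteq> 0" "D1' \<noteq> 0" "D2' \<noteq> 0"
    using qfac_neq_0[OF q] by (simp_all add: D1_def D2_def D1'_def D2'_def)
  have aj: "a (j - 1) \<ge> b j" if "j \<noteq> 1"
    using 1(2)[of "j - 1"] j that by simp
  have p: "p \<noteq> 0" using one_minus_power_neq_0[OF q] aj s by (auto simp: p_def)
  have E1: "D1' = D1 * p"
  proof -
    \<comment> \<open>Index 0 lies outside \<open>{1..L}\<close>, so the left product acquires no
      factor; for j = 1 neither does the right one.\<close>
    have "a i - s (i + 1) + of_bool (i = 0) = a i - b (i + 1) + of_bool (i = j - 1)"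
      if "i \<in> {1..L}" for i
      using that 1(2)[of i] s(1) s(2)[of "i + 1"] j by (cases "i + 1 = j") auto
    from prod_qfac_shift[of "{1..L}", OF _ this] have "D1' = D1 * (if j - 1 \<in> {1..L} then 1 - q ^ Suc (a (j - 1) - b (j - 1 + 1)) else 1)"
      by (simp add: D1_def D1'_def del: power_Suc)
    moreover have "Suc (a (j - 1) - b (j - 1 + 1)) = a (j - 1) - s j" if "j \<noteq> 1"
      using aj s j that by auto
    ultimately show ?thesis using j by (auto simp: p_def simp del: power_Suc)
  qed
  have E2: "D2' * y = D2"
  proof -
    have "s i - a i + of_bool (i = j) = b i - a i + of_bool (i = 0)" if "i \<in> {1..L}" for i
      using that s(1) s(2)[of i] lt by (cases "i = j") auto
    from prod_qfac_shift[of "{1..L}", OF _ this] have "D2' * (if j \<in> {1..L} then 1 - q ^ Suc (s j - a j) else 1) = D2"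
      by (simp add: D2_def D2'_def del: power_Suc)
    moreover have "Suc (s j - a j) = b j - a j" using lt s by auto
    ultimately show ?thesis using j by (auto simp: y_def simp del: power_Suc)
  qed
  have W: "bump_weight q a s False (Suc L) j = p * (\<Prod>i=j..L. q ^ (a i - b (i + 1)))"
  proof -
    have "(\<Prod>i=j+1..Suc L. 1 - bump_factor q a s False (Suc L) i) = (\<Prod>i=Suc j..Suc L. q ^ (a (i-1) - b i))"
      using j s by (intro prod.cong) (auto simp: bump_factor_def)
    also have "\<dots> = (\<Prod>i=j..L. q ^ (a i - b (i + 1)))"
      by (subst prod.shift_bounds_cl_Suc_ivl) simp
    finally show ?thesis by (simp add: bump_weight_def bump_factor_def p_def)
  qed
  have K: "kappa_step q L a s * (p * X) = y * X * kappa_step q L a b" for X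
    unfolding kappa_step_def prod.distrib N_def[symmetric] D1_def[symmetric] D2_def[symmetric]
      D1'_def[symmetric] D2'_def[symmetric]
    using E1 E2[symmetric] p nz by (simp add: field_simps)
  have "j = Suc L \<Longrightarrow> (\<Prod>i=j..L. q ^ (a i - b (i + 1))) = 1" by simp
  with j show ?thesis unfolding W K by (cases "j = Suc L") (simp_all add: y_def)
qed

text \<open>Together with \<open>box_factor\<close> the numerator changes by \<open>v\<close>, and
  the two denominator products by \<open>p / x\<close> and \<open>z / y\<close>. The bump weight is
  \<open>p * X * z / v\<close>, so everything cancels except \<open>x\<close>, \<open>y\<close> and
  the powers of q collected in \<open>X\<close>.\<close>

lemma kappa_step_remove:
  assumes q: "\<not> root_of_unity q" and ab: "interlaces a b" and b: "b = add_unit s j"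
    and a: "a = add_unit t m" and j: "1 \<le> j" "j \<le> m" "m \<le> L"
    and lt: "b (m + 1) < a m" "m = j \<or> a j < b j"
  shows "box_factor q L a m * kappa_step q L t s * bump_weight q t s True m j =
         (1 - q ^ (a m - b (m + 1))) *
         (if m = j then 1 else (1 - q ^ (b j - a j)) * (\<Prod>i=j..m-1. q ^ (a i - b (i + 1))))
         * kappa_step q L a b"
proof -
  have 1: "a i \<le> b i" "1 \<le> i \<Longrightarrow> b (Suc i) \<le> a i" "1 \<le> i \<Longrightarrow> a (Suc i) \<le> a i" for i
    using ab interlaces_decreasing[OF ab] by (auto simp: interlaces_def)
  have s: "b j = Suc (s j)" "\<And>i. i \<noteq> j \<Longrightarrow> s i = b i"
    using b by (auto simp: add_unit_def)
  have t: "a m = Suc (t m)" "\<And>i. i \<noteq> m \<Longrightarrow> t i = a i"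
    using a by (auto simp: add_unit_def)
  define p where "p = (if j = 1 then 1 else 1 - q ^ (a (j - 1) - s j))"
  define v where "v = (if m = 1 then 1 else 1 - q ^ (a (m - 1) - t m))"
  define y where "y = (if m = j then 1 else 1 - q ^ (b j - a j))"
  define z where "z = (if m = j then 1 else 1 - q ^ (b m - t m))"
  define x where "x = 1 - q ^ (a m - b (m + 1))"
  define N N' where "N = (\<Prod>i=1..L-1. qfac q (a i - a (i + 1)))"
    and "N' = (\<Prod>i=1..L-1. qfac q (t i - t (i + 1)))"
  define D1 D2 D1' D2' where "D1 = (\<Prod>i=1..L. qfac q (a i - b (i + 1)))"
    and "D2 = (\<Prod>i=1..L. qfac q (b i - a i))"
    and "D1' = (\<Prod>i=1..L. qfac q (t i - s (i + 1)))"
    and "D2' = (\<Prod>i=1..L. qfac q (s i - t i))"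
  have nz: "D1 \<noteq> 0" "D2 \<noteq> 0" "D1' \<noteq> 0" "D2' \<noteq> 0"
    using qfac_neq_0[OF q] by (simp_all add: D1_def D2_def D1'_def D2'_def)
  have aj: "a (j - 1) \<ge> b j" if "j \<noteq> 1"
    using 1(2)[of "j - 1"] j that by simp
  have am: "a (m - 1) \<ge> a m" "a (m - 1) \<ge> b m" if "m \<noteq> 1"
    using 1(2)[of "m - 1"] 1(3)[of "m - 1"] j that by simp_all
  have "p \<noteq> 0"
    using one_minus_power_neq_0[OF q, of "a (j - 1) - s j"] aj s(1) by (cases "j = 1") (simp_all add: p_def)
  moreover have "v \<noteq> 0"
    using one_minus_power_neq_0[OF q, of "a (m - 1) - t m"] am t(1) by (cases "m = 1") (simp_all add: v_def)
  moreover have "z \<noteq> 0"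
    using one_minus_power_neq_0[OF q, of "b m - t m"] 1(1)[of m] t(1) by (simp add: z_def)
  ultimately have nz': "p \<noteq> 0" "v \<noteq> 0" "z \<noteq> 0" .
  have EN: "N' * box_factor q L a m = N * v"
  proof -
    \<comment> \<open>The numerator stops at index L - 1: for m = L it has no factor for row
      \<open>m\<close>, which matches the value 1 of \<open>box_factor\<close>.\<close>
    have "t i - t (i + 1) + of_bool (i = m) = a i - a (i + 1) + of_bool (i = m - 1)"
      if "i \<in> {1..L-1}" for i
    proof -
      have "a (Suc m) < a m" using 1(1)[of "Suc m"] lt by simp
      then show ?thesis
        using that 1(3)[of i] t(1) t(2)[of i] t(2)[of "Suc i"] by (cases "i = m"; cases "Suc i = m") auto
    qed
    from prod_qfac_shift[of "{1..L-1}", OF _ this]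
    have "N' * (if m \<in> {1..L-1} then 1 - q ^ Suc (t m - t (m + 1)) else 1) =
      N * (if m - 1 \<in> {1..L-1} then 1 - q ^ Suc (a (m - 1) - a (m - 1 + 1)) else 1)"
      by (simp add: N_def N'_def del: power_Suc)
    moreover have "Suc (t m - t (m + 1)) = a m - a (m + 1)"
      using 1(1)[of "Suc m"] lt t(1) t(2)[of "Suc m"] by simp
    moreover have "Suc (a (m - 1) - a (m - 1 + 1)) = a (m - 1) - t m" if "m \<noteq> 1"
      using that j am t by simp
    moreover have "m \<in> {1..L-1} \<longleftrightarrow> m < L" "m - 1 \<in> {1..L-1} \<longleftrightarrow> m \<noteq> 1"
      using j by auto
    ultimately show ?thesis
      by (auto simp: v_def box_factor_def simp del: power_Suc split: if_splits)
  qed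
  have E1: "D1' * x = D1 * p"
  proof -
    have "t i - s (i + 1) + of_bool (i = m) = a i - b (i + 1) + of_bool (i = j - 1)"
      if "i \<in> {1..L}" for i
      using that 1(2)[of i] s(1) s(2)[of "i + 1"] t(1) t(2)[of i] lt j
      by (cases "i = m"; cases "i + 1 = j") auto
    from prod_qfac_shift[of "{1..L}", OF _ this]
    have "D1' * (if m \<in> {1..L} then 1 - q ^ Suc (t m - s (m + 1)) else 1) =
      D1 * (if j - 1 \<in> {1..L} then 1 - q ^ Suc (a (j - 1) - b (j - 1 + 1)) else 1)"
      by (simp add: D1_def D1'_def del: power_Suc)
    moreover have "Suc (a (j - 1) - b (j - 1 + 1)) = a (j - 1) - s j" if "j \<noteq> 1"
      using aj s j that by auto
    moreover have "Suc (t m - s (m + 1)) = a m - b (m + 1)"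
      using t s(2)[of "m + 1"] lt j by auto
    moreover have "m \<in> {1..L}" "j - 1 \<in> {1..L} \<longleftrightarrow> j \<noteq> 1"
      using j by auto
    ultimately show ?thesis by (auto simp: p_def x_def simp del: power_Suc split: if_splits)
  qed
  have E2: "D2' * y = D2 * z"
  proof (cases "m = j")
    case True
    have "D2' = D2" unfolding D2_def D2'_def
    proof (intro prod.cong refl arg_cong[of _ _ "qfac q"])
      fix i show "s i - t i = b i - a i"
        using True s(1) s(2)[of i] t(1) t(2)[of i] by (cases "i = m") auto
    qed
    then show ?thesis using True by (simp add: y_def z_def)
  next
    case False
    have "s i - t i + of_bool (i = j) = b i - a i + of_bool (i = m)" if "i \<in> {1..L}" for i
      using that s(1) s(2)[of i] t(1) t(2)[of i] lt 1(1)[of i] False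
      by (cases "i = m"; cases "i = j") auto
    from prod_qfac_shift[of "{1..L}", OF _ this]
    have "D2' * (if j \<in> {1..L} then 1 - q ^ Suc (s j - t j) else 1) =
      D2 * (if m \<in> {1..L} then 1 - q ^ Suc (b m - a m) else 1)"
      by (simp add: D2_def D2'_def del: power_Suc)
    moreover have "Suc (s j - t j) = b j - a j" "Suc (b m - a m) = b m - t m"
      using lt s t(1) t(2)[of j] 1(1)[of m] False by auto
    ultimately show ?thesis using j False by (auto simp: y_def z_def simp del: power_Suc)
  qed
  define X where "X = (if m = j then 1 else (\<Prod>i=j..m-1. q ^ (a i - b (i + 1))))"
  have W: "bump_weight q t s True m j = p * X * z / v"
  proof (cases "m = j")
    case True
    have "a (m - 1) - t m = t (m - 1) - t m" if "m \<noteq> 1"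
      using that t(2)[of "m - 1"] j by simp
    then show ?thesis using True t(2)[of "m - 1"] j
      by (auto simp: bump_weight_def bump_factor_def p_def X_def z_def v_def)
  next
    case False
    have fj: "bump_factor q t s True m j = p"
      using False j t(2)[of "j - 1"] by (auto simp: bump_factor_def p_def)
    have m1: "m \<noteq> 1" "t (m - 1) = a (m - 1)" "s m = b m" using False j t(2)[of "m - 1"] s(2)[of m] by auto
    have "(\<Prod>i=j+1..m. 1 - bump_factor q t s True m i) =
       (\<Prod>i=j+1..m-1. 1 - bump_factor q t s True m i) * (1 - bump_factor q t s True m m)"
      using False j prod.nat_ivl_Suc'[of "j+1" "m-1" "\<lambda>i. 1 - bump_factor q t s True m i"] by (simp add: mult.commute)
    also have "(\<Prod>i=j+1..m-1. 1 - bump_factor q t s True m i) = (\<Prod>i=j+1..m-1. q ^ (a (i - 1) - b i))"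
    proof (rule prod.cong[OF refl])
      fix i assume i: "i \<in> {j+1..m-1}"
      then have "t (i - 1) = a (i - 1)" "s i = b i" using t(2)[of "i - 1"] s(2)[of i] j False by auto
      then show "1 - bump_factor q t s True m i = q ^ (a (i - 1) - b i)"
        using i j by (auto simp: bump_factor_def)
    qed
    \<comment> \<open>Row \<open>m\<close> is where the quotient \<open>f1\<close> applies. Over the
      denominator \<open>v\<close>, the difference of two powers of q splits off
      \<open>q ^ (a (m - 1) - b m)\<close> and leaves \<open>z\<close>.\<close>
    also have "1 - bump_factor q t s True m m = q ^ (a (m - 1) - b m) * z / v"
    proof -
      have "1 - bump_factor q t s True m m = 1 - (1 - q ^ (a (m - 1) - b m)) / v"
        using m1 by (simp add: bump_factor_def v_def)
      also have "\<dots> = (q ^ (a (m - 1) - b m) - q ^ (a (m - 1) - t m)) / v"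
        using nz' m1 by (simp add: field_simps v_def)
      also have "a (m - 1) - t m = (a (m - 1) - b m) + (b m - t m)"
        using am m1 1(1)[of m] t by simp
      finally show ?thesis using False by (simp add: z_def power_add algebra_simps)
    qed
    also have "(\<Prod>i=j+1..m-1. q ^ (a (i - 1) - b i)) * (q ^ (a (m - 1) - b m) * z / v) =
       (\<Prod>i=j+1..m. q ^ (a (i - 1) - b i)) * z / v"
      using False j prod.nat_ivl_Suc'[of "j+1" "m-1" "\<lambda>i. q ^ (a (i - 1) - b i)"] by (simp add: mult.commute)
    also have "(\<Prod>i=j+1..m. q ^ (a (i - 1) - b i)) = X"
      using False j prod.shift_bounds_cl_Suc_ivl[of "\<lambda>i. q ^ (a (i - 1) - b i)" j "m - 1"]
      by (simp add: X_def)
    finally show ?thesis by (simp add: bump_weight_def fj)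
  qed
  have "box_factor q L a m * kappa_step q L t s * bump_weight q t s True m j =
    (N' * box_factor q L a m) / (D1' * D2') * (p * X * z / v)"
    unfolding W unfolding kappa_step_def prod.distrib N'_def[symmetric] D1'_def[symmetric] D2'_def[symmetric]
    by simp
  also have "\<dots> = N / (D1' * D2') * (p * X * z)"
    unfolding EN using nz' by simp
  also have "\<dots> = x * (y * X) * (N / (D1 * D2))"
  proof -
    have "N * (p * X * z) * (D1 * D2) = N * X * (D1 * p) * (D2 * z)" by simp
    also have "\<dots> = x * (y * X) * N * (D1' * D2')"
      unfolding E1[symmetric] E2[symmetric] by simp
    finally show ?thesis using nz by (simp add: field_simps)
  qed
  also have "N / (D1 * D2) = kappa_step q L a b"
    by (simp add: kappa_step_def prod.distrib N_def D1_def D2_def)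
  also have "y * X = (if m = j then 1 else (1 - q ^ (b j - a j)) * (\<Prod>i=j..m-1. q ^ (a i - b (i + 1))))"
    by (simp add: y_def X_def)
  finally show ?thesis by (simp add: x_def)
qed

text \<open>Each summand is the product up to m - 1 minus the product up to m, so the sum equals
  \<open>x j\<close> minus the full product.\<close>

lemma telescope_prod:
  fixes x :: "nat \<Rightarrow> 'a::comm_ring_1"
  assumes "j \<le> L"
  shows "(\<Sum>m=Suc j..L. (1 - x m) * (\<Prod>i=j..m-1. x i)) + (\<Prod>i=j..L. x i) = x j"
  using assms
proof (induction L rule: dec_induct)
  case base
  then show ?case by simp
next
  case (step n)
  then show ?case by (simp add: algebra_simps)
qed

text \<open>The conditions of the form \<open>interlaces \<dots>\<close> hold exactly when the factors \<open>1 - x\<^sub>m\<close> and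
  \<open>1 - q\<^bsup>b\<^sub>j - a\<^sub>j\<^esup>\<close> that arise do not vanish, so they can be dropped before the sum is telescoped.\<close>

lemma kappa_step_bump_sum:
  assumes q: "\<not> root_of_unity q" and ab: "interlaces a b" and b: "b = add_unit s j"
    and j: "1 \<le> j" "j \<le> Suc L" and a0: "a (Suc L) = 0"
  shows "(\<Sum>m=j..L. if 0 < a m \<and> interlaces (a(m := a m - 1)) s
             then box_factor q L a m * kappa_step q L (a(m := a m - 1)) s *
                  bump_weight q (a(m := a m - 1)) s True m j else 0) +
         (if interlaces a s then kappa_step q L a s * bump_weight q a s False (Suc L) j else 0) =
         box_factor q (Suc L) b j * kappa_step q L a b"
proof -
  define x where "x i = q ^ (a i - b (i + 1))" for i
  define y where "y = 1 - q ^ (b j - a j)"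
  have 1: "a i \<le> b i" "1 \<le> i \<Longrightarrow> b (Suc i) \<le> a i" for i
    using ab by (auto simp: interlaces_def)
  have T: "(if 0 < a m \<and> interlaces (a(m := a m - 1)) s
             then box_factor q L a m * kappa_step q L (a(m := a m - 1)) s *
                  bump_weight q (a(m := a m - 1)) s True m j else 0) =
          (1 - x m) * (if m = j then 1 else y * (\<Prod>i=j..m-1. x i)) * kappa_step q L a b"
    if m: "m \<in> {j..L}" for m
  proof (cases "b (m + 1) < a m \<and> (m = j \<or> a j < b j)")
    case True
    then have a: "a = add_unit (a(m := a m - 1)) m" by (auto simp: add_unit_def)
    have "interlaces (a(m := a m - 1)) s"
      using interlaces_remove_iff[OF ab b j(1) _ a] m True by auto
    moreover note kappa_step_remove[OF q ab b a, of L]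
    ultimately show ?thesis using m j True by (simp add: x_def y_def)
  next
    case False
    have "\<not> (0 < a m \<and> interlaces (a(m := a m - 1)) s)"
    proof
      assume *: "0 < a m \<and> interlaces (a(m := a m - 1)) s"
      then have a: "a = add_unit (a(m := a m - 1)) m" by (auto simp: add_unit_def)
      show False using interlaces_remove_iff[OF ab b j(1) _ a] m False * by auto
    qed
    moreover have "b (m + 1) = a m \<or> (m \<noteq> j \<and> a j = b j)"
      using False 1(1)[of j] 1(2)[of m] m j by force
    ultimately show ?thesis by (auto simp: x_def y_def)
  qed
  have S: "(if interlaces a s then kappa_step q L a s * bump_weight q a s False (Suc L) j else 0) =
     (if j \<le> L then y * (\<Prod>i=j..L. x i) else 1) * kappa_step q L a b"
  proof (cases "a j < b j")
    case True
    then show ?thesis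
      using interlaces_remove_iff'[OF ab b j(1)] kappa_step_remove_start[OF q ab b j True]
      by (simp add: x_def y_def)
  next
    case False
    then have "a j = b j" using 1(1)[of j] by simp
    moreover have "j \<noteq> Suc L" using False a0 b by (auto simp: add_unit_def)
    ultimately show ?thesis
      using interlaces_remove_iff'[OF ab b j(1)] j by (simp add: y_def)
  qed
  show ?thesis
  proof (cases "j \<le> L")
    case False
    then show ?thesis using S j by (simp add: box_factor_def)
  next
    case True
    have "(\<Sum>m=j..L. (1 - x m) * (if m = j then 1 else y * (\<Prod>i=j..m-1. x i)) * kappa_step q L a b)
      = ((1 - x j) + y * (\<Sum>m=Suc j..L. (1 - x m) * (\<Prod>i=j..m-1. x i))) * kappa_step q L a b"
      using True by (simp add: sum.atLeast_Suc_atMost[of j] sum_distrib_left sum_distrib_right algebra_simps)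
    then have "(\<Sum>m=j..L. (1 - x m) * (if m = j then 1 else y * (\<Prod>i=j..m-1. x i)) * kappa_step q L a b)
       + y * (\<Prod>i=j..L. x i) * kappa_step q L a b =
       ((1 - x j) + y * ((\<Sum>m=Suc j..L. (1 - x m) * (\<Prod>i=j..m-1. x i)) + (\<Prod>i=j..L. x i))) * kappa_step q L a b"
      by (simp only: distrib_left distrib_right add.assoc)
    also have "\<dots> = ((1 - x j) + y * x j) * kappa_step q L a b"
      unfolding telescope_prod[OF True] by simp
    \<comment> \<open>The exponents \<open>b j - a j\<close> and \<open>a j - b (j + 1)\<close> add
      up, so \<open>a\<close> disappears from the result.\<close>
    also have "(1 - x j) + y * x j = 1 - q ^ (b j - b (j + 1))"
    proof -
      have "b j - b (j + 1) = (b j - a j) + (a j - b (j + 1))"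
        using 1(1)[of j] 1(2)[of j] j by simp
      then show ?thesis by (simp add: x_def y_def power_add algebra_simps)
    qed
    finally show ?thesis using True j S T by (simp add: box_factor_def)
  qed
qed


section \<open>Tableaux and Gelfand--Tsetlin patterns\<close>

text \<open>In a sorted list the entries at most \<open>i\<close> form an initial segment.\<close>

lemma nth_le_iff_less_length_filter:
  fixes r :: "nat list"
  assumes "sorted r" "c < length r"
  shows "r ! c \<le> i \<longleftrightarrow> c < length (filter (\<lambda>x. x \<le> i) r)"
  using assms
proof (induction r arbitrary: c)
  case Nil
  then show ?case by simp
next
  case (Cons x r)
  show ?case
  proof (cases "x \<le> i")
    case True
    then show ?thesis using Cons by (cases c) auto
  next
    case False
    then have "filter (\<lambda>y. y \<le> i) (x # r) = []"
      using Cons.prems(1) by (force simp: filter_empty_conv)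
    moreover have "x \<le> (x # r) ! c"
      using Cons.prems by (cases c) auto
    ultimately show ?thesis using False by simp
  qed
qed

section \<open>Shapes of subtableaux as counts of row entries\<close>

definition row :: "tableau \<Rightarrow> nat \<Rightarrow> nat list" where
  "row T j = (if 1 \<le> j \<and> j \<le> length T then T ! (j - 1) else [])"

lemma sh_eq_length_row: "sh T j = length (row T j)"
  by (simp add: sh_def row_def)

lemma row_Cons: "row (r # T) j = (if j = 1 then r else row T (j - 1))"
  by (auto simp: row_def nth_Cons')

text \<open>Since row lengths decrease weakly, empty rows stand at the end and deleting them moves
  no other row.\<close>

lemma sh_filter_nonempty:
  assumes "sorted_wrt (\<ge>) (map length T)"
  shows "sh (filter (\<lambda>r. r \<noteq> []) T) j = length (row T j)"
  using assms
proof (induction T arbitrary: j)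
  case Nil
  then show ?case by (auto simp: sh_def row_def)
next
  case (Cons r T)
  show ?case
  proof (cases "r = []")
    case True
    then have *: "\<forall>r'\<in>set (r # T). r' = []" using Cons.prems by auto
    then have "filter (\<lambda>r. r \<noteq> []) (r # T) = []" by (auto simp: filter_empty_conv)
    moreover have "row (r # T) j = []"
      using * nth_mem[of "j - 1" "r # T"] by (auto simp: row_def)
    ultimately show ?thesis by (auto simp: sh_def)
  next
    case False
    then show ?thesis
      using Cons by (simp add: sh_eq_length_row row_Cons)
  qed
qed

lemma is_tableau_rows:
  assumes "is_tableau T"
  shows "sorted (row T j)"
    and "1 \<le> j \<Longrightarrow> length (row T (Suc j)) \<le> length (row T j)"
    and "1 \<le> j \<Longrightarrow> c < length (row T (Suc j)) \<Longrightarrow> row T j ! c < row T (Suc j) ! c"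
proof -
  show "sorted (row T j)"
    using assms by (auto simp: is_tableau_def row_def)
  show "length (row T (Suc j)) \<le> length (row T j)" if "1 \<le> j"
    using assms that sorted_wrt_nth_less[of "(\<ge>)" "map length T" "j - 1" j]
    by (auto simp: is_tableau_def row_def)
  show "row T j ! c < row T (Suc j) ! c" if "1 \<le> j" "c < length (row T (Suc j))"
  proof -
    have "\<forall>i j. Suc i < length T \<longrightarrow> j < length (T ! Suc i) \<longrightarrow> T ! i ! j < T ! Suc i ! j"
      using assms by (simp add: is_tableau_def)
    from this[rule_format, of "j - 1" c] that show ?thesis
      by (auto simp: row_def split: if_splits)
  qed
qed

text \<open>Strictness of the columns of \<open>T\<close> is the interlacing \<open>\<lambda>\<^sup>i\<^sup>+\<^sup>1\<^sub>j\<^sub>+\<^sub>1 \<le> \<lambda>\<^sup>i\<^sub>j\<close>.\<close>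

lemma length_filter_row_Suc_le:
  assumes "is_tableau T" "1 \<le> j"
  shows "length (filter (\<lambda>x. x \<le> Suc i) (row T (Suc j))) \<le> length (filter (\<lambda>x. x \<le> i) (row T j))"
proof (rule ccontr)
  define c where "c = length (filter (\<lambda>x. x \<le> i) (row T j))"
  assume "\<not> ?thesis"
  then have c: "c < length (filter (\<lambda>x. x \<le> Suc i) (row T (Suc j)))" by (simp add: c_def)
  then have c1: "c < length (row T (Suc j))"
    by (meson length_filter_le less_le_trans)
  then have c2: "c < length (row T j)"
    using is_tableau_rows(2)[OF assms] by simp
  have "row T (Suc j) ! c \<le> Suc i"
    using nth_le_iff_less_length_filter[OF is_tableau_rows(1)[OF assms(1)] c1] c by blast
  then have "row T j ! c \<le> i"
    using is_tableau_rows(3)[OF assms c1] by simp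
  then have "c < length (filter (\<lambda>x. x \<le> i) (row T j))"
    using nth_le_iff_less_length_filter[OF is_tableau_rows(1)[OF assms(1)] c2] by blast
  then show False by (simp add: c_def)
qed

lemma length_filter_mono:
  assumes "\<And>x. P x \<Longrightarrow> R x"
  shows "length (filter P xs) \<le> length (filter R xs)"
  using assms by (induction xs) auto

text \<open>By the column condition the row lengths still decrease weakly after restriction to
  entries at most \<open>i\<close>, so \<open>subtab\<close> deletes rows only at the end and row
  indices are kept.\<close>

lemma subsh_eq_length_filter:
  assumes "is_tableau T"
  shows "subsh T i j = length (filter (\<lambda>x. x \<le> i) (row T j))"
proof -
  let ?T = "map (filter (\<lambda>x. x \<le> i)) T"
  have r: "row ?T j = filter (\<lambda>x. x \<le> i) (row T j)" for j
    by (auto simp: row_def)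
  have "sorted_wrt (\<ge>) (map length ?T)"
  proof (subst sorted_wrt_iff_nth_Suc_transp)
    show "transp ((\<ge>) :: nat \<Rightarrow> nat \<Rightarrow> bool)" by (rule transp_on_ge)
    show "\<forall>k. Suc k < length (map length ?T) \<longrightarrow> map length ?T ! Suc k \<le> map length ?T ! k"
    proof (intro allI impI)
      fix k assume k: "Suc k < length (map length ?T)"
      have "length (filter (\<lambda>x. x \<le> i) (row T (Suc (Suc k)))) \<le>
          length (filter (\<lambda>x. x \<le> Suc i) (row T (Suc (Suc k))))"
        by (rule length_filter_mono) simp
      also have "\<dots> \<le> length (filter (\<lambda>x. x \<le> i) (row T (Suc k)))"
        using length_filter_row_Suc_le[OF assms, of "Suc k" i] by simp
      finally show "map length ?T ! Suc k \<le> map length ?T ! k"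
        using k by (simp add: row_def)
    qed
  qed
  from sh_filter_nonempty[OF this] show ?thesis
    by (simp add: subsh_def subtab_def r)
qed

text \<open>Patterns are continued constantly beyond level \<open>l\<close>, as is the sequence of shapes of a tableau with
  entries at most \<open>l\<close>.\<close>

definition patterns :: "nat \<Rightarrow> (nat \<Rightarrow> nat \<Rightarrow> nat) set" where
  "patterns l = {g. g 0 = (\<lambda>_. 0) \<and> (\<forall>i. interlaces (g i) (g (Suc i))) \<and> (\<forall>i\<ge>l. g i = g l)}"

text \<open>By interlacing, the number of nonzero parts grows by at most one from each level to the
  next.\<close>

lemma pattern_eq_0:
  assumes "g 0 = (\<lambda>_. 0)" "\<forall>i<l. interlaces (g i) (g (Suc i))" "i \<le> l" "i < j"
  shows "g i j = 0"
  using assms(3,4)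
proof (induction i arbitrary: j)
  case 0
  then show ?case using assms by simp
next
  case (Suc i)
  then obtain k where k: "j = Suc k" "i < k" by (cases j) auto
  then have "g i k = 0" "interlaces (g i) (g (Suc i))" using assms(2) Suc by auto
  moreover have "1 \<le> k" using k by simp
  ultimately have "g (Suc i) (Suc k) \<le> 0" unfolding interlaces_def by metis
  then show ?case using k by simp
qed

lemma pattern_mono:
  assumes "g \<in> patterns l" "i \<le> k"
  shows "g i j \<le> g k j"
  using assms(2)
proof (induction k rule: dec_induct)
  case (step n)
  then show ?case using assms(1) unfolding patterns_def interlaces_def
    by (metis (no_types, lifting) mem_Collect_eq order_trans)
qed simp

lemma set_row_subset: "set (row T j) \<subseteq> set (concat T)"
proof (cases "1 \<le> j \<and> j \<le> length T")
  case True
  then have "T ! (j - 1) \<in> set T" by (intro nth_mem) auto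
  then show ?thesis using True unfolding row_def by auto
qed (auto simp: row_def)

lemma filter_le_top:
  assumes "T \<in> tableaux l" "i \<ge> l"
  shows "filter (\<lambda>x. x \<le> i) (row T j) = row T j"
proof -
  have "set (row T j) \<subseteq> {1..l}"
    using assms(1) set_row_subset[of T j] unfolding tableaux_def by blast
  then show ?thesis using assms(2) by (auto simp: filter_id_conv)
qed

lemma subsh_top:
  assumes "T \<in> tableaux l" "i \<ge> l"
  shows "subsh T i = sh T"
proof
  fix j
  have "is_tableau T" using assms(1) by (simp add: tableaux_def)
  then show "subsh T i j = sh T j"
    by (simp only: subsh_eq_length_filter filter_le_top[OF assms] sh_eq_length_row)
qed

lemma subsh_in_patterns:
  assumes "T \<in> tableaux l"
  shows "subsh T \<in> patterns l"
proof -
  have T: "is_tableau T" "set (concat T) \<subseteq> {1..l}" using assms by (auto simp: tableaux_def)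
  have "subsh T 0 = (\<lambda>_. 0)"
  proof
    fix j
    have "set (row T j) \<subseteq> {1..l}"
      using T(2) set_row_subset[of T j] by blast
    then have "filter (\<lambda>x. x \<le> 0) (row T j) = []" by (auto simp: filter_empty_conv)
    then show "subsh T 0 j = 0" unfolding subsh_eq_length_filter[OF T(1)] by (simp only: list.size)
  qed
  moreover have "interlaces (subsh T i) (subsh T (Suc i))" for i
    unfolding interlaces_def subsh_eq_length_filter[OF T(1)]
    by (auto intro: length_filter_mono length_filter_row_Suc_le[OF T(1)]) (simp_all add: row_def)
  moreover have "subsh T i = subsh T l" if "i \<ge> l" for i
    using that by (simp add: subsh_top[OF assms])
  ultimately show ?thesis unfolding patterns_def by blast
qed

text \<open>The entry of a box is the least \<open>i\<close> for which the box lies in the shape of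
  level \<open>i\<close>, so the shapes determine the tableau.\<close>

lemma inj_on_subsh: "inj_on subsh (tableaux l)"
proof (rule inj_onI)
  fix T U assume TU: "T \<in> tableaux l" "U \<in> tableaux l" "subsh T = subsh U"
  then have t: "is_tableau T" "is_tableau U" by (auto simp: tableaux_def)
  have "sh T = sh U" using subsh_top[OF TU(1) order_refl] subsh_top[OF TU(2) order_refl] TU(3) by simp
  from sh_eq_imp_lengths[OF t this] have len: "map length T = map length U" .
  show "T = U"
  proof (rule nth_equalityI)
    show l: "length T = length U" using len by (metis length_map)
    fix j assume j: "j < length T"
    show "T ! j = U ! j"
    proof (rule nth_equalityI)
      show l': "length (T ! j) = length (U ! j)"
        using j l arg_cong[OF len, of "\<lambda>x. x ! j"] by simp
      fix c assume c: "c < length (T ! j)"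
      have "T ! j ! c \<le> i \<longleftrightarrow> U ! j ! c \<le> i" for i
      proof -
        have "length (filter (\<lambda>x. x \<le> i) (T ! j)) = length (filter (\<lambda>x. x \<le> i) (U ! j))"
          using subsh_eq_length_filter[OF t(1), of i "Suc j"] subsh_eq_length_filter[OF t(2), of i "Suc j"]
            TU(3) j l by (simp add: row_def)
        moreover have "sorted (T ! j)" "sorted (U ! j)"
          using t j l by (auto simp: is_tableau_def)
        ultimately show ?thesis
          using nth_le_iff_less_length_filter c l' by simp
      qed
      then show "T ! j ! c = U ! j ! c" by (meson antisym order_refl)
    qed
  qed
qed

text \<open>Row \<open>j\<close> of the tableau belonging to \<open>g\<close>: each letter is
  written once for every box by which part \<open>j\<close> grows at its level.\<close>

primrec pattern_row :: "(nat \<Rightarrow> nat \<Rightarrow> nat) \<Rightarrow> nat \<Rightarrow> nat \<Rightarrow> nat list" where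
  "pattern_row g j 0 = []"
| "pattern_row g j (Suc l) = pattern_row g j l @ replicate (g (Suc l) j - g l j) (Suc l)"

lemma set_pattern_row: "set (pattern_row g j l) \<subseteq> {1..l}"
  by (induction l) (auto simp: subset_iff le_Suc_eq)

lemma sorted_pattern_row: "sorted (pattern_row g j l)"
  by (induction l) (use set_pattern_row in \<open>fastforce simp: sorted_append\<close>)+

lemma length_filter_pattern_row:
  assumes "g 0 = (\<lambda>_. 0)" "\<forall>i<l. g i j \<le> g (Suc i) j"
  shows "length (filter (\<lambda>x. x \<le> i) (pattern_row g j l)) = g (min i l) j"
  using assms(2)
proof (induction l)
  case 0
  then show ?case using assms(1) by simp
next
  case (Suc l)
  show ?case
  proof (cases "i \<le> l")
    case True
    then show ?thesis using Suc by (auto simp: min_def)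
  next
    case False
    then have "min i (Suc l) = Suc l" "min i l = l" by auto
    then show ?thesis using Suc False by auto
  qed
qed

lemma ex_tableau_of_pattern:
  assumes g: "g \<in> patterns l"
  shows "\<exists>T\<in>tableaux l. subsh T = g"
proof -
  have g0: "g 0 = (\<lambda>_. 0)" and gi: "\<And>i. interlaces (g i) (g (Suc i))" and gl: "\<And>i. i \<ge> l \<Longrightarrow> g i = g l"
    using g unfolding patterns_def by blast+
  have cnt: "length (filter (\<lambda>x. x \<le> i) (pattern_row g j l)) = g i j" for i j
  proof -
    have "g (min i l) = g i" by (metis gl min.absorb1 min.absorb2 nat_le_linear)
    then show ?thesis
      using length_filter_pattern_row[of g l j i] g0 gi by (simp add: interlaces_def)
  qed
  have len: "length (pattern_row g j l) = g l j" for j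
  proof -
    have "filter (\<lambda>x. x \<le> l) (pattern_row g j l) = pattern_row g j l"
      using set_pattern_row[of g j l] by (auto simp: filter_id_conv)
    then show ?thesis using cnt[of l j] by simp
  qed
  \<comment> \<open>The number of nonzero parts of the top shape; only these rows are kept, as a
    tableau has no empty rows.\<close>
  define r where "r = (LEAST r. g l (Suc r) = 0)"
  have "g l (Suc l) = 0" using pattern_eq_0[of g l l "Suc l"] g0 gi by simp
  then have r0: "g l (Suc r) = 0" unfolding r_def by (rule LeastI)
  have rpos: "g l (Suc j) > 0" if "j < r" for j
    using not_less_Least[OF that[unfolded r_def]] by simp
  have dec: "g l (Suc j) \<le> g l j" if "1 \<le> j" for j
    using interlaces_decreasing(1)[OF gi that] .
  have beyond: "g l j = 0" if "r < j" for j
    using that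
  proof (induction j)
    case (Suc j)
    then show ?case using r0 dec[of j] by (cases "j = r") auto
  qed simp
  define T where "T = map (\<lambda>j. pattern_row g (Suc j) l) [0..<r]"
  have row: "row T j = (if 1 \<le> j \<and> j \<le> r then pattern_row g j l else [])" for j
    by (auto simp: row_def T_def)
  have "is_tableau T"
    unfolding is_tableau_def
  proof (intro conjI allI impI ballI)
    show "[] \<notin> set T"
    proof
      assume "[] \<in> set T"
      then obtain j where "j < r" "pattern_row g (Suc j) l = []" by (auto simp: T_def)
      then show False using rpos[of j] len[of "Suc j"] by simp
    qed
    show "sorted_wrt (\<ge>) (map length T)"
      by (subst sorted_wrt_iff_nth_Suc_transp[OF transp_on_ge])
        (auto simp: T_def len intro: dec)
    show "sorted s" if "s \<in> set T" for s
      using that sorted_pattern_row by (auto simp: T_def)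
    fix i j assume i: "Suc i < length T" and j: "j < length (T ! Suc i)"
    define x where "x = T ! Suc i ! j"
    have ir: "Suc i < r" using i by (simp add: T_def)
    have Tn: "T ! Suc i = pattern_row g (Suc (Suc i)) l" "T ! i = pattern_row g (Suc i) l"
      using ir by (simp_all add: T_def)
    have "x \<in> {1..l}"
      using set_pattern_row[of g "Suc (Suc i)" l] nth_mem[OF j] Tn by (auto simp: x_def)
    then have x: "x \<ge> 1" by simp
    \<comment> \<open>The lower box lies in the shape of level \<open>x\<close>. By interlacing the
      box above it lies in that of level x - 1, so its entry is smaller.\<close>
    have "j < g x (Suc (Suc i))"
      using nth_le_iff_less_length_filter[OF sorted_pattern_row, of j g "Suc (Suc i)" l x] j Tn cnt
      by (simp add: x_def)
    also have "\<dots> \<le> g (x - 1) (Suc i)"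
      using gi[of "x - 1"] x by (simp add: interlaces_def)
    finally have "j < g (x - 1) (Suc i)" .
    moreover have "j < length (pattern_row g (Suc i) l)"
      using j Tn len dec[of "Suc i"] by simp
    ultimately have "T ! i ! j \<le> x - 1"
      using nth_le_iff_less_length_filter[OF sorted_pattern_row, of j g "Suc i" l "x - 1"] Tn cnt by simp
    then show "T ! i ! j < T ! Suc i ! j" using x by (simp add: x_def)
  qed
  moreover have "set (concat T) \<subseteq> {1..l}"
    using set_pattern_row by (fastforce simp: T_def)
  moreover have "subsh T i j = g i j" for i j
  proof (cases "1 \<le> j \<and> j \<le> r")
    case True
    then show ?thesis by (simp add: subsh_eq_length_filter[OF \<open>is_tableau T\<close>] row cnt)
  next
    case False
    have "g i 0 = 0" using gi by (simp add: interlaces_def)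
    moreover have "g i j = 0" if "r < j"
      using beyond[OF that] pattern_mono[OF g, of i l j] by (metis gl le_zero_eq nat_le_linear)
    ultimately show ?thesis using False
      by (cases "j = 0") (auto simp add: subsh_eq_length_filter[OF \<open>is_tableau T\<close>] row)
  qed
  then have "subsh T = g" by (intro ext)
  ultimately show ?thesis by (intro bexI[of _ T]) (simp_all only: tableaux_def mem_Collect_eq)
qed

text \<open>Turns sums over tableaux of a given shape into sums over patterns with a given top
  level.\<close>

lemma bij_betw_subsh:
  "bij_betw subsh {P \<in> tableaux l. sh P = s} {g \<in> patterns l. g l = s}"
proof (rule bij_betwI')
  show "(subsh P = subsh R) = (P = R)"
    if "P \<in> {P \<in> tableaux l. sh P = s}" "R \<in> {P \<in> tableaux l. sh P = s}" for P R
    using inj_onD[OF inj_on_subsh, of P R l] that by auto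
  show "subsh P \<in> {g \<in> patterns l. g l = s}" if "P \<in> {P \<in> tableaux l. sh P = s}" for P
    using that subsh_in_patterns subsh_top[of P l l] by auto
  show "\<exists>P\<in>{P \<in> tableaux l. sh P = s}. g = subsh P" if "g \<in> {g \<in> patterns l. g l = s}" for g
    using that ex_tableau_of_pattern[of g l] subsh_top[of _ l l] by force
qed

lemma finite_patterns: "finite {g \<in> patterns l. g l = s}"
  using bij_betw_finite[OF bij_betw_subsh] finite_tableaux_shape by blast

section \<open>The change of type along a path\<close>

lemma length_filter_Suc_count:
  "length (filter (\<lambda>x. x \<le> Suc i) xs) = length (filter (\<lambda>x. x \<le> i) xs) + count_list xs (Suc i)"
  by (induction xs) auto

lemma length_filter_concat_eq_sum_subsh:
  assumes "is_tableau T" "length T \<le> M"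
  shows "length (filter (\<lambda>x. x \<le> i) (concat T)) = (\<Sum>j=1..M. subsh T i j)"
proof -
  have "length (filter (\<lambda>x. x \<le> i) (concat T)) = (\<Sum>j<length T. length (filter (\<lambda>x. x \<le> i) (T ! j)))"
    by (simp add: filter_concat length_concat o_def sum_list_sum_nth atLeast0LessThan)
  also have "\<dots> = (\<Sum>j=1..length T. length (filter (\<lambda>x. x \<le> i) (row T j)))"
    by (rule sum.reindex_bij_witness[of _ "\<lambda>j. j - 1" Suc]) (auto simp: row_def)
  also have "\<dots> = (\<Sum>j=1..M. length (filter (\<lambda>x. x \<le> i) (row T j)))"
    using assms(2) by (intro sum.mono_neutral_left) (auto simp: row_def)
  finally show ?thesis by (simp add: subsh_eq_length_filter[OF assms(1)])
qed

lemma is_path_le: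
  assumes J: "is_path l k P P' J" and "1 \<le> k" "k \<le> i" "i \<le> l"
  shows "J i \<le> k"
  using assms(3,4)
proof (induction i rule: dec_induct)
  case base
  then show ?case using J unfolding is_path_def by (metis atLeastAtMost_iff order_refl)
next
  case (step n)
  have "\<forall>i\<in>{k..l}. J i \<le> J (i - 1)" using J by (simp add: is_path_def)
  from bspec[OF this, of "Suc n"] have "J (Suc n) \<le> J n" using step by simp
  then show ?case using step by simp
qed

text \<open>The number of entries at most \<open>i\<close> is the size of the shape of level
  \<open>i\<close>, which grows by one box exactly for i \<ge> k. Differences of consecutive levels
  give the multiplicities.\<close>

lemma ty_of_path:
  assumes P: "P \<in> tableaux l" "P' \<in> tableaux l" and k: "1 \<le> k" "k \<le> l"
    and J: "is_path l k P P' J"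
  shows "ty P' = add_unit (ty P) k"
proof -
  have t: "is_tableau P" "is_tableau P'" using P by (auto simp: tableaux_def)
  let ?N = "\<lambda>T i. length (filter (\<lambda>x. x \<le> i) (concat T))"
  define M where "M = length P + length P' + k"
  note Jk = is_path_le[OF J k(1)]
  have N: "?N P' i = ?N P i + of_bool (k \<le> i)" for i
  proof -
    have "(\<Sum>j=1..M. subsh P' i j) = (\<Sum>j=1..M. subsh P i j) + of_bool (k \<le> i)"
    proof (cases "k \<le> i")
      case False
      then show ?thesis using J by (auto simp: is_path_def)
    next
      case True
      \<comment> \<open>The path is specified only up to level \<open>l\<close>, beyond which the
        shapes are constant, so larger levels are read off at \<open>l\<close>.\<close>
      define i' where "i' = min i l"
      have i': "i' \<in> {k..l}" using True k by (simp add: i'_def)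
      have "subsh P' i = subsh P' i'" "subsh P i = subsh P i'"
        using subsh_top[OF P(1)] subsh_top[OF P(2)] by (auto simp: i'_def min_def)
      then have e: "subsh P' i = add_unit (subsh P i) (J i')" and j: "J i' \<in> {1..M}"
        using J i' Jk[of i'] by (auto simp: is_path_def M_def)
      have "(\<Sum>j=1..M. subsh P' i j) = (\<Sum>j=1..M. subsh P i j + of_bool (j = J i'))"
        unfolding e by (rule sum.cong) (auto simp: add_unit_def)
      also have "\<dots> = (\<Sum>j=1..M. subsh P i j) + 1"
        using j by (simp add: sum.distrib of_bool_def sum.delta)
      finally show ?thesis using True by simp
    qed
    then show ?thesis
      using length_filter_concat_eq_sum_subsh[OF t(1), of M] length_filter_concat_eq_sum_subsh[OF t(2), of M]
      by (simp add: M_def)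
  qed
  show ?thesis
  proof
    fix i show "ty P' i = add_unit (ty P) k i"
    proof (cases i)
      case 0
      have "count_list (concat T) 0 = 0" if "T \<in> tableaux l" for T
        using that by (fastforce simp: tableaux_def count_list_0_iff)
      then show ?thesis using 0 k P by (simp add: ty_def add_unit_def)
    next
      case (Suc m)
      show ?thesis
        using N[of m] N[of i] length_filter_Suc_count[of m "concat P"] length_filter_Suc_count[of m "concat P'"]
        unfolding Suc ty_def add_unit_def
        by (cases "k = Suc m") (auto split: if_splits simp: of_bool_def)
    qed
  qed
qed


section \<open>Recursion over the levels of a pattern\<close>

text \<open>The end \<open>j\<close> of the path at level \<open>l\<close> is an argument. In the sum over \<open>m = j\<^sub>l\<close> only the term with
  \<open>h l = add_unit (g l) m\<close> can be nonzero.\<close>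

primrec pattern_kernel ::
    "complex \<Rightarrow> (nat \<Rightarrow> nat \<Rightarrow> nat) \<Rightarrow> (nat \<Rightarrow> nat \<Rightarrow> nat) \<Rightarrow> nat \<Rightarrow> nat \<Rightarrow> nat \<Rightarrow> complex" where
  "pattern_kernel q g h k 0 j = 0"
| "pattern_kernel q g h k (Suc l) j =
     (if 1 \<le> j \<and> h (Suc l) = add_unit (g (Suc l)) j
      then if k = Suc l
           then if j \<le> k \<and> (\<forall>i<k. h i = g i) then bump_weight q (g l) (g (Suc l)) False k j else 0
           else \<Sum>m=j..l. pattern_kernel q g h k l m * bump_weight q (g l) (g (Suc l)) True m j
      else 0)"

definition pattern_kappa :: "complex \<Rightarrow> nat \<Rightarrow> (nat \<Rightarrow> nat \<Rightarrow> nat) \<Rightarrow> complex" where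
  "pattern_kappa q l g = (\<Prod>i<l. kappa_step q i (g i) (g (Suc i)))"

text \<open>Groups \<open>kappa\<close> by pairs of consecutive levels. The factor for level 0 and
  the numerator for j = 1, which are absent from \<open>kappa\<close>, are empty products.\<close>

lemma kappa_eq_pattern_kappa: "kappa q l P = pattern_kappa q l (subsh P)"
proof -
  have "pattern_kappa q l (subsh P) = (\<Prod>i=1..l-1. kappa_step q i (subsh P i) (subsh P (i + 1)))"
    unfolding pattern_kappa_def
    by (rule prod.mono_neutral_cong_right) (auto simp: kappa_step_def)
  moreover have "(\<Prod>j=2..l-1. \<Prod>i=1..j-1. qfac q (subsh P j i - subsh P j (i + 1))) =
      (\<Prod>j=1..l-1. \<Prod>i=1..j-1. qfac q (subsh P j i - subsh P j (i + 1)))"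
  proof (rule prod.mono_neutral_left)
    show "\<forall>j\<in>{1..l-1} - {2..l-1}. (\<Prod>i=1..j-1. qfac q (subsh P j i - subsh P j (i + 1))) = 1"
    proof
      fix j assume "j \<in> {1..l-1} - {2..l-1}"
      then have "j = 1" by auto
      then show "(\<Prod>i=1..j-1. qfac q (subsh P j i - subsh P j (i + 1))) = 1" by simp
    qed
  qed auto
  ultimately show ?thesis
    by (simp add: kappa_def kappa_step_def prod_dividef)
qed

text \<open>Only the levels of \<open>g\<close> up to \<open>l\<close> enter, which allows the top
  level of a pattern to be split off.\<close>

lemma pattern_kernel_cong:
  assumes "\<And>i. i \<le> l \<Longrightarrow> g i = g' i"
  shows "pattern_kernel q g h k l j = pattern_kernel q g' h k l j"
  using assms
proof (induction l arbitrary: j)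
  case (Suc l)
  have "pattern_kernel q g h k l m = pattern_kernel q g' h k l m" for m
    using Suc by simp
  moreover have "(\<forall>i<Suc l. h i = g i) \<longleftrightarrow> (\<forall>i<Suc l. h i = g' i)"
    using Suc.prems by auto
  moreover have "g l = g' l" "g (Suc l) = g' (Suc l)" using Suc.prems by auto
  ultimately show ?case
    by (cases "k = Suc l") (simp_all only: pattern_kernel.simps if_True if_False simp_thms)
qed simp

lemma pattern_kernel_nonzeroD:
  assumes "pattern_kernel q g h k l j \<noteq> 0"
  shows "h l = add_unit (g l) j"
  using assms by (cases l) (auto split: if_splits)

section \<open>The kernel as a recursion over levels\<close>

lemma ff_eq_bump_factor:
  "ff q k P J i j = bump_factor q (subsh P (i - 1)) (subsh P i) (i \<noteq> k) (J (i - 1)) j"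
  by (simp add: ff_def f0_def f1_def bump_factor_def)

lemma path_weight_eq:
  "path_weight q l k P J =
     (\<Prod>i=k..l. bump_weight q (subsh P (i - 1)) (subsh P i) (i \<noteq> k) (J (i - 1)) (J i))"
  by (simp add: path_weight_def ff_eq_bump_factor bump_weight_def)

text \<open>The shapes at level \<open>n\<close> determine the row of the added box, so the sum over
  \<open>m\<close> in the recursion collapses to the term m = \<open>J n\<close>.\<close>

lemma pattern_kernel_eq_path_weight:
  assumes "is_path l k P P' J" "1 \<le> k" "k \<le> l"
  shows "pattern_kernel q (subsh P) (subsh P') k l (J l) = path_weight q l k P J"
  using assms(3,1)
proof (induction l rule: dec_induct)
  case base
  obtain k' where k': "k = Suc k'" using assms(2) by (cases k) auto
  have "J k' = k" "1 \<le> J k" "J k \<le> k" "\<forall>i<k. subsh P' i = subsh P i"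
    "subsh P' k = add_unit (subsh P k) (J k)"
    using base unfolding is_path_def k' by auto
  then show ?case unfolding path_weight_eq by (simp add: k')
next
  case (step n)
  have J: "is_path n k P P' J" using step.prems by (auto simp: is_path_def)
  have *: "1 \<le> J (Suc n)" "J (Suc n) \<le> J n" "subsh P' (Suc n) = add_unit (subsh P (Suc n)) (J (Suc n))"
  proof -
    have "\<forall>i\<in>{k..Suc n}. 1 \<le> J i \<and> J i \<le> J (i - 1) \<and> subsh P' i = add_unit (subsh P i) (J i)"
      using step.prems unfolding is_path_def by blast
    from bspec[OF this, of "Suc n"] show "1 \<le> J (Suc n)" "J (Suc n) \<le> J n"
      "subsh P' (Suc n) = add_unit (subsh P (Suc n)) (J (Suc n))"
      using step.hyps by auto
  qed
  have Jn: "J n \<le> n" using is_path_le[OF J assms(2) step.hyps(1) order_refl] step.hyps by simp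
  have n: "subsh P' n = add_unit (subsh P n) (J n)"
    using J step.hyps by (simp add: is_path_def)
  let ?b = "\<lambda>m. bump_weight q (subsh P n) (subsh P (Suc n)) True m (J (Suc n))"
  have "pattern_kernel q (subsh P) (subsh P') k (Suc n) (J (Suc n)) =
      (\<Sum>m=J (Suc n)..n. pattern_kernel q (subsh P) (subsh P') k n m * ?b m)"
    using * step.hyps by simp
  also have "\<dots> = (\<Sum>m\<in>{J n}. pattern_kernel q (subsh P) (subsh P') k n m * ?b m)"
  proof (rule sum.mono_neutral_right)
    show "\<forall>m\<in>{J (Suc n)..n} - {J n}. pattern_kernel q (subsh P) (subsh P') k n m * ?b m = 0"
      using pattern_kernel_nonzeroD n add_unit_inject by (metis DiffE insertI1 mult_eq_0_iff)
  qed (use * Jn in auto)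
  also have "\<dots> = path_weight q (Suc n) k P J"
    using step.IH[OF J] step.hyps by (simp add: path_weight_eq)
  finally show ?case .
qed

text \<open>A nonzero sum has a nonzero term, and its index \<open>m\<close> is the preceding row of
  the path. The path is thus built upwards from level \<open>k\<close>.\<close>

lemma ex_path_of_pattern_kernel:
  assumes "pattern_kernel q (subsh P) (subsh P') k l j \<noteq> 0" "1 \<le> k"
  shows "k \<le> l \<and> (\<exists>J. is_path l k P P' J \<and> J l = j)"
  using assms(1)
proof (induction l arbitrary: j)
  case (Suc l)
  have j: "1 \<le> j" "subsh P' (Suc l) = add_unit (subsh P (Suc l)) j"
    using Suc.prems by (auto split: if_splits)
  show ?case
  proof (cases "k = Suc l")
    case True
    then have "j \<le> k" "\<forall>i<k. subsh P' i = subsh P i"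
      using Suc.prems by (auto split: if_splits)
    then have "is_path (Suc l) k P P' ((\<lambda>_. k)(Suc l := j))"
      using True j by (auto simp: is_path_def)
    then show ?thesis using True by (metis fun_upd_same order_refl)
  next
    case False
    have "(\<Sum>m=j..l. pattern_kernel q (subsh P) (subsh P') k l m *
        bump_weight q (subsh P l) (subsh P (Suc l)) True m j) \<noteq> 0"
      using Suc.prems j False by simp
    then obtain m where m: "m \<in> {j..l}" "pattern_kernel q (subsh P) (subsh P') k l m \<noteq> 0"
      by (rule sum.not_neutral_contains_not_neutral) auto
    from Suc.IH[OF m(2)] obtain J where J: "k \<le> l" "is_path l k P P' J" "J l = m" by auto
    have "is_path (Suc l) k P P' (J(Suc l := j))"
      unfolding is_path_def
    proof (intro conjI ballI)
      show "(J(Suc l := j)) (k - 1) = k" using J by (auto simp: is_path_def)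
      show "\<forall>i<k. subsh P' i = subsh P i" using J by (auto simp: is_path_def)
      fix i assume i: "i \<in> {k..Suc l}"
      have "i = Suc l \<or> i \<in> {k..l} \<and> i \<noteq> Suc l \<and> i - 1 \<noteq> Suc l" using i by auto
      then show "1 \<le> (J(Suc l := j)) i" "(J(Suc l := j)) i \<le> (J(Suc l := j)) (i - 1)"
        "subsh P' i = add_unit (subsh P i) ((J(Suc l := j)) i)"
        using J(2,3) j m(1) unfolding is_path_def by auto
    qed
    then show ?thesis using J(1) by (metis fun_upd_same le_SucI)
  qed
qed simp

text \<open>The end \<open>j\<close> of the path is fixed by the two top shapes. If no path exists,
  both sides vanish.\<close>

lemma kernel_eq_pattern_kernel:
  assumes "P \<in> tableaux l" "P' \<in> tableaux l" "1 \<le> k" "k \<le> l" "sh P' = add_unit (sh P) j"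
  shows "kernel q l k P P' = pattern_kernel q (subsh P) (subsh P') k l j"
proof (cases "\<exists>J. is_path l k P P' J")
  case True
  then obtain J where J: "is_path l k P P' J" by blast
  have "subsh P' l = add_unit (subsh P l) (J l)"
    using J assms by (simp add: is_path_def)
  then have "J l = j"
    using assms(5) subsh_top[OF assms(1), of l] subsh_top[OF assms(2), of l]
    by (metis add_unit_inject order_refl)
  then show ?thesis
    using kernel_eq[OF ty_of_path[OF assms(1-4) J] J] pattern_kernel_eq_path_weight[OF J assms(3,4)]
    by simp
next
  case False
  then show ?thesis
    using ex_path_of_pattern_kernel[of q P P' k l j] assms(3) by (auto simp: kernel_def)
qed

text \<open>The constant continuation by \<open>s\<close> needs \<open>s\<close> to interlace
  itself, that is, to be weakly decreasing; this follows from the interlacing with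
  \<open>t\<close>.\<close>

lemma patterns_extend:
  assumes "interlaces t s" "g \<in> patterns l" "g l = t"
  shows "(\<lambda>i. if i \<le> l then g i else s) \<in> patterns (Suc l)"
proof -
  have "interlaces s s"
    using interlaces_decreasing(2)[OF assms(1)] assms(1) by (auto simp: interlaces_def)
  moreover have "g i = g l" if "i \<ge> l" for i
    using assms(2) that unfolding patterns_def by blast
  ultimately show ?thesis
    using assms unfolding patterns_def by (auto simp: not_le less_Suc_eq_le dest: le_antisym)
qed

text \<open>Forgetting level l + 1 is a bijection onto the patterns with top level \<open>t\<close>
  if \<open>t\<close> and \<open>s\<close> interlace; otherwise the sum is empty. The assumption
  says that \<open>F\<close> ignores the levels above \<open>l\<close>.\<close>

lemma sum_patterns_Suc:
  fixes F :: "(nat \<Rightarrow> nat \<Rightarrow> nat) \<Rightarrow> complex"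
  assumes F: "\<And>g g'. (\<And>i. i \<le> l \<Longrightarrow> g i = g' i) \<Longrightarrow> F g = F g'"
  shows "(\<Sum>g | g \<in> patterns (Suc l) \<and> g (Suc l) = s \<and> g l = t. F g) =
         (if interlaces t s then \<Sum>g | g \<in> patterns l \<and> g l = t. F g else 0)"
proof (cases "interlaces t s")
  case False
  have "g \<notin> patterns (Suc l) \<or> g (Suc l) \<noteq> s \<or> g l \<noteq> t" for g
    using False unfolding patterns_def by blast
  then have "{g. g \<in> patterns (Suc l) \<and> g (Suc l) = s \<and> g l = t} = {}" by blast
  then show ?thesis using False by (simp only: sum.empty if_False)
next
  case True
  have "(\<Sum>g | g \<in> patterns (Suc l) \<and> g (Suc l) = s \<and> g l = t. F g) =
      (\<Sum>g | g \<in> patterns l \<and> g l = t. F g)"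
  proof (rule sum.reindex_bij_witness[of _ "\<lambda>g i. if i \<le> l then g i else s" "\<lambda>g i. g (min i l)"])
    fix g assume g: "g \<in> {g \<in> patterns (Suc l). g (Suc l) = s \<and> g l = t}"
    have top: "g i = s" if "i \<ge> Suc l" for i
      using g that unfolding patterns_def by blast
    then show "(\<lambda>i. if i \<le> l then g (min i l) else s) = g"
      by (auto simp: fun_eq_iff not_le Suc_le_eq)
    have "interlaces t t"
      using interlaces_decreasing(1)[OF True] True by (auto simp: interlaces_def)
    moreover have "g 0 = (\<lambda>_. 0)" "\<And>i. interlaces (g i) (g (Suc i))"
      using g unfolding patterns_def by blast+
    ultimately show "(\<lambda>i. g (min i l)) \<in> {g \<in> patterns l. g l = t}"
      using g unfolding patterns_def by (auto simp: min_def not_less_eq_eq dest: le_antisym)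
    show "F (\<lambda>i. g (min i l)) = F g" by (rule F) simp
  next
    fix g assume g: "g \<in> {g \<in> patterns l. g l = t}"
    have top: "g i = g l" if "i \<ge> l" for i
      using g that unfolding patterns_def by blast
    show "(\<lambda>i. if min i l \<le> l then g (min i l) else s) = g"
    proof
      fix i show "(if min i l \<le> l then g (min i l) else s) = g i"
        using top[of i] by (cases "i \<le> l") auto
    qed
    show "(\<lambda>i. if i \<le> l then g i else s) \<in> {g \<in> patterns (Suc l). g (Suc l) = s \<and> g l = t}"
      using patterns_extend[OF True] g by auto
  qed
  then show ?thesis using True by simp
qed

lemma add_unit_eq_iff: "a = add_unit t m \<longleftrightarrow> 0 < a m \<and> t = a(m := a m - 1)"
  by (auto simp: add_unit_def)

text \<open>Induction on \<open>l\<close>. Paths with k = l + 1 start at the top level and force the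
  lower levels of \<open>g\<close> to be those of \<open>h\<close>. For k \<le> l and a fixed row
  \<open>m\<close> at level \<open>l\<close>, the induction hypothesis evaluates the sum over the
  lower levels. Both contributions together are summed by
  \<open>kappa_step_bump_sum\<close>.\<close>

lemma sum_pattern_kernel:
  assumes q: "\<not> root_of_unity q" and h0: "h 0 = (\<lambda>_. 0)"
    and "\<forall>i<l. interlaces (h i) (h (Suc i))"
    and "h l = add_unit s j" "1 \<le> j" "j \<le> l"
  shows "(\<Sum>k=1..l. \<Sum>g | g \<in> patterns l \<and> g l = s. pattern_kappa q l g * pattern_kernel q g h k l j) =
         box_factor q l (h l) j * pattern_kappa q l h"
  using assms(3-)
proof (induction l arbitrary: s j)
  case 0
  then show ?case by simp
next
  case (Suc l)
  define a where "a = h l"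
  have ab: "interlaces a (h (Suc l))" using Suc.prems(1) by (simp add: a_def)
  have a0: "a (Suc l) = 0"
    unfolding a_def by (rule pattern_eq_0[of h l l "Suc l"]) (use h0 Suc.prems in auto)
  define G where "G = {g \<in> patterns (Suc l). g (Suc l) = s}"
  define t where "t m = a(m := a m - 1)" for m
  have finG: "finite G" unfolding G_def by (rule finite_patterns)
  have kap: "pattern_kappa q (Suc l) g = pattern_kappa q l g * kappa_step q l (g l) (g (Suc l))" for g
    by (simp add: pattern_kappa_def)
  have kap_cong: "pattern_kappa q l g = pattern_kappa q l g'" if "\<And>i. i \<le> l \<Longrightarrow> g i = g' i" for g g'
    using that by (simp add: pattern_kappa_def)
  \<comment> \<open>The only candidate for \<open>g\<close> when the path starts at level l +
    1.\<close>
  define H where "H = (\<lambda>i. if i \<le> l then h i else s)"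
  have start: "(\<Sum>g\<in>G. pattern_kappa q (Suc l) g * pattern_kernel q g h (Suc l) (Suc l) j) =
      (if interlaces a s then pattern_kappa q l h *
        (kappa_step q l a s * bump_weight q a s False (Suc l) j) else 0)"
  proof -
    have "(\<Sum>g\<in>G. pattern_kappa q (Suc l) g * pattern_kernel q g h (Suc l) (Suc l) j) =
        (\<Sum>g\<in>G. if g = H then pattern_kappa q l h *
        (kappa_step q l a s * bump_weight q a s False (Suc l) j) else 0)"
    proof (rule sum.cong[OF refl])
      fix g assume "g \<in> G"
      then have g: "g (Suc l) = s" "\<And>i. i > l \<Longrightarrow> g i = s"
        unfolding G_def patterns_def by (blast dest: Suc_leI)+
      have iff: "(\<forall>i<Suc l. h i = g i) \<longleftrightarrow> g = H"
        using g(2) by (auto simp: H_def fun_eq_iff less_Suc_eq_le)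
      show "pattern_kappa q (Suc l) g * pattern_kernel q g h (Suc l) (Suc l) j =
        (if g = H then pattern_kappa q l h *
        (kappa_step q l a s * bump_weight q a s False (Suc l) j) else 0)"
      proof (cases "\<forall>i<Suc l. h i = g i")
        case True
        then have "pattern_kappa q l g = pattern_kappa q l h" "g l = a"
          by (auto intro: kap_cong simp: a_def)
        then show ?thesis
          using True iff Suc.prems g(1) by (simp add: kap)
      next
        case False
        then have "pattern_kernel q g h (Suc l) (Suc l) j = 0" by auto
        then show ?thesis using iff False by simp
      qed
    qed
    also have "\<dots> = (if H \<in> G then pattern_kappa q l h *
        (kappa_step q l a s * bump_weight q a s False (Suc l) j) else 0)"
      using finG by (simp add: sum.delta)
    also have "H \<in> G \<longleftrightarrow> interlaces a s"
    proof
      assume "H \<in> G"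
      then have "interlaces (H l) (H (Suc l))"
        unfolding G_def patterns_def by blast
      then show "interlaces a s" by (simp add: a_def H_def)
    next
      assume as: "interlaces a s"
      have "interlaces s s"
        using interlaces_decreasing[OF as] as by (auto simp: interlaces_def)
      then have "interlaces (H i) (H (Suc i))" for i
        using as Suc.prems(1) by (cases i l rule: linorder_cases) (auto simp: H_def a_def)
      moreover have "H 0 = (\<lambda>_. 0)" "H (Suc l) = s" "\<forall>i\<ge>Suc l. H i = H (Suc l)"
        using h0 by (auto simp: H_def)
      ultimately show "H \<in> G"
        unfolding G_def patterns_def by blast
    qed
    finally show ?thesis .
  qed
  have bump: "(\<Sum>k=1..l. \<Sum>g\<in>G. pattern_kappa q (Suc l) g * pattern_kernel q g h k (Suc l) j) =
    (\<Sum>m=j..l. if 0 < a m \<and> interlaces (t m) s then pattern_kappa q l h *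
       (box_factor q l a m * kappa_step q l (t m) s * bump_weight q (t m) s True m j) else 0)"
  proof -
    define w where "w m = kappa_step q l (t m) s * bump_weight q (t m) s True m j" for m
    have "(\<Sum>k=1..l. \<Sum>g\<in>G. pattern_kappa q (Suc l) g * pattern_kernel q g h k (Suc l) j) =
       (\<Sum>k=1..l. \<Sum>g\<in>G. \<Sum>m=j..l. if g l = t m \<and> 0 < a m
          then w m * (pattern_kappa q l g * pattern_kernel q g h k l m) else 0)"
    proof (intro sum.cong refl)
      fix k g assume k: "k \<in> {1..l}" and "g \<in> G"
      then have g: "g (Suc l) = s" by (simp add: G_def)
      have "pattern_kappa q (Suc l) g * pattern_kernel q g h k (Suc l) j =
        (\<Sum>m=j..l. pattern_kappa q l g * kappa_step q l (g l) s *
           (pattern_kernel q g h k l m * bump_weight q (g l) s True m j))"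
        using k g Suc.prems by (simp add: kap sum_distrib_left)
      \<comment> \<open>A nonzero kernel forces \<open>h l\<close> to be \<open>g l\<close> with a
        box added in row \<open>m\<close>, so the condition on \<open>g l\<close> may be
        inserted.\<close>
      also have "\<dots> = (\<Sum>m=j..l. if g l = t m \<and> 0 < a m
          then w m * (pattern_kappa q l g * pattern_kernel q g h k l m) else 0)"
      proof (rule sum.cong[OF refl])
        fix m
        show "pattern_kappa q l g * kappa_step q l (g l) s *
           (pattern_kernel q g h k l m * bump_weight q (g l) s True m j) =
          (if g l = t m \<and> 0 < a m
          then w m * (pattern_kappa q l g * pattern_kernel q g h k l m) else 0)"
          using pattern_kernel_nonzeroD[of q g h k l m] add_unit_eq_iff[of a "g l" m]
          by (cases "pattern_kernel q g h k l m = 0") (auto simp: w_def a_def t_def)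
      qed
      finally show "pattern_kappa q (Suc l) g * pattern_kernel q g h k (Suc l) j =
        (\<Sum>m=j..l. if g l = t m \<and> 0 < a m
          then w m * (pattern_kappa q l g * pattern_kernel q g h k l m) else 0)" .
    qed
    also have "\<dots> = (\<Sum>m=j..l. \<Sum>k=1..l. \<Sum>g\<in>G. if g l = t m \<and> 0 < a m
          then w m * (pattern_kappa q l g * pattern_kernel q g h k l m) else 0)"
      by (subst sum.swap[of _ "{j..l}" G]) (rule sum.swap)
    also have "\<dots> = (\<Sum>m=j..l. if 0 < a m \<and> interlaces (t m) s then pattern_kappa q l h *
       (box_factor q l a m * kappa_step q l (t m) s * bump_weight q (t m) s True m j) else 0)"
    proof (rule sum.cong[OF refl])
      fix m assume m: "m \<in> {j..l}"
      show "(\<Sum>k=1..l. \<Sum>g\<in>G. if g l = t m \<and> 0 < a m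
          then w m * (pattern_kappa q l g * pattern_kernel q g h k l m) else 0) =
        (if 0 < a m \<and> interlaces (t m) s then pattern_kappa q l h *
       (box_factor q l a m * kappa_step q l (t m) s * bump_weight q (t m) s True m j) else 0)"
      proof (cases "0 < a m")
        case True
        have "(\<Sum>g\<in>G. if g l = t m \<and> 0 < a m
          then w m * (pattern_kappa q l g * pattern_kernel q g h k l m) else 0) =
          (if interlaces (t m) s then \<Sum>g | g \<in> patterns l \<and> g l = t m.
            w m * (pattern_kappa q l g * pattern_kernel q g h k l m) else 0)" for k
        proof -
          have "(\<Sum>g\<in>G. if g l = t m \<and> 0 < a m
              then w m * (pattern_kappa q l g * pattern_kernel q g h k l m) else 0) =
            (\<Sum>g\<in>G \<inter> {g. g l = t m}. w m * (pattern_kappa q l g * pattern_kernel q g h k l m))"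
            using finG True by (simp add: sum.inter_restrict)
          also have "G \<inter> {g. g l = t m} = {g. g \<in> patterns (Suc l) \<and> g (Suc l) = s \<and> g l = t m}"
            by (auto simp: G_def)
          also have "(\<Sum>g\<in>\<dots>. w m * (pattern_kappa q l g * pattern_kernel q g h k l m)) =
            (if interlaces (t m) s then \<Sum>g | g \<in> patterns l \<and> g l = t m.
            w m * (pattern_kappa q l g * pattern_kernel q g h k l m) else 0)"
          proof (rule sum_patterns_Suc)
            fix g g' :: "nat \<Rightarrow> nat \<Rightarrow> nat" assume "\<And>i. i \<le> l \<Longrightarrow> g i = g' i"
            then show "w m * (pattern_kappa q l g * pattern_kernel q g h k l m) =
              w m * (pattern_kappa q l g' * pattern_kernel q g' h k l m)"
              using kap_cong[of g g'] pattern_kernel_cong[of l g g'] by simp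
          qed
          finally show ?thesis .
        qed
        moreover have "(\<Sum>k=1..l. \<Sum>g | g \<in> patterns l \<and> g l = t m.
            w m * (pattern_kappa q l g * pattern_kernel q g h k l m)) =
            w m * (box_factor q l a m * pattern_kappa q l h)"
        proof -
          have "a = add_unit (t m) m" using True by (simp add: add_unit_def t_def)
          then have "(\<Sum>k=1..l. \<Sum>g | g \<in> patterns l \<and> g l = t m.
            pattern_kappa q l g * pattern_kernel q g h k l m) = box_factor q l a m * pattern_kappa q l h"
            using Suc.IH[of "t m" m] Suc.prems m by (simp add: a_def)
          then show ?thesis by (simp add: sum_distrib_left[symmetric])
        qed
        ultimately show ?thesis using True by (simp add: w_def)
      qed simp
    qed
    finally show ?thesis .
  qed
  have "(\<Sum>k=1..Suc l. \<Sum>g\<in>G. pattern_kappa q (Suc l) g * pattern_kernel q g h k (Suc l) j) =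
    pattern_kappa q l h * ((\<Sum>m=j..l. if 0 < a m \<and> interlaces (t m) s
       then box_factor q l a m * kappa_step q l (t m) s * bump_weight q (t m) s True m j else 0) +
     (if interlaces a s then kappa_step q l a s * bump_weight q a s False (Suc l) j else 0))"
    using start bump
    by (simp add: distrib_left sum_distrib_left if_distrib[of "(*) (pattern_kappa q l h)"]
        del: pattern_kernel.simps cong: if_cong)
  also have "\<dots> = pattern_kappa q l h * (box_factor q (Suc l) (h (Suc l)) j * kappa_step q l a (h (Suc l)))"
    unfolding t_def using kappa_step_bump_sum[OF q ab Suc.prems(2-4) a0] by simp
  finally show ?case by (simp add: kap G_def a_def mult_ac)
qed


section \<open>Summation over words\<close>

text \<open>The identity for one insertion step. The inverse q-factorial of part \<open>l\<close>
  supplies, for j = l, the factor that \<open>box_factor\<close> omits, so the result has the same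
  form for every row \<open>j\<close>.\<close>

lemma sum_kappa_kernel:
  assumes q: "\<not> root_of_unity q" and P': "P' \<in> tableaux l"
    and s: "sh P' = add_unit s j" "1 \<le> j"
  shows "(\<Sum>k=1..l. \<Sum>P | P \<in> tableaux l \<and> sh P = s.
            inverse (qfac q (s l)) * kappa q l P * kernel q l k P P') =
         inverse (qfac q (sh P' l)) * kappa q l P' * (1 - q ^ (sh P' j - sh P' (j + 1)))"
proof -
  define h where "h = subsh P'"
  have h: "h \<in> patterns l" unfolding h_def by (rule subsh_in_patterns[OF P'])
  then have h0: "h 0 = (\<lambda>_. 0)" and hi: "\<forall>i<l. interlaces (h i) (h (Suc i))"
    unfolding patterns_def by blast+
  have hl: "h l = sh P'" unfolding h_def by (rule subsh_top[OF P' order_refl])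
  have beyond: "sh P' i = 0" if "l < i" for i
    using pattern_eq_0[OF h0 hi order_refl that] hl by simp
  have j: "j \<le> l"
    using beyond[of j] s by (force simp: add_unit_def)
  have "(\<Sum>k=1..l. \<Sum>P | P \<in> tableaux l \<and> sh P = s.
            inverse (qfac q (s l)) * kappa q l P * kernel q l k P P') =
      (\<Sum>k=1..l. \<Sum>P\<in>{P \<in> tableaux l. sh P = s}. inverse (qfac q (s l)) *
         (pattern_kappa q l (subsh P) * pattern_kernel q (subsh P) h k l j))"
    using P' s by (intro sum.cong refl)
      (auto simp: kernel_eq_pattern_kernel kappa_eq_pattern_kappa h_def)
  also have "\<dots> = (\<Sum>k=1..l. \<Sum>g\<in>{g \<in> patterns l. g l = s}. inverse (qfac q (s l)) *
         (pattern_kappa q l g * pattern_kernel q g h k l j))"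
    by (intro sum.cong refl sum.reindex_bij_betw bij_betw_subsh)
  also have "\<dots> = inverse (qfac q (s l)) * (box_factor q l (sh P') j * pattern_kappa q l h)"
    using sum_pattern_kernel[OF q h0 hi, of s j] s j hl by (simp add: sum_distrib_left[symmetric])
  also have "inverse (qfac q (s l)) * box_factor q l (sh P') j =
      inverse (qfac q (sh P' l)) * (1 - q ^ (sh P' j - sh P' (j + 1)))"
  proof (cases "j = l")
    case True
    then have "sh P' l = Suc (s l)" "sh P' (j + 1) = 0"
      using s beyond by (auto simp: add_unit_def)
    then show ?thesis
      using True one_minus_power_neq_0[OF q, of "Suc (s l)"]
      by (simp add: box_factor_def qfac_Suc del: power_Suc)
  next
    case False
    then show ?thesis using s j by (simp add: box_factor_def add_unit_def)
  qed
  then have "inverse (qfac q (s l)) * (box_factor q l (sh P') j * pattern_kappa q l h) =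
      inverse (qfac q (sh P' l)) * pattern_kappa q l h * (1 - q ^ (sh P' j - sh P' (j + 1)))"
    by (simp add: mult_ac)
  finally show ?thesis by (simp add: kappa_eq_pattern_kappa h_def)
qed

section \<open>Insertion into the empty tableau\<close>

lemma sh_eq_zero_iff: "is_tableau P \<Longrightarrow> sh P = (\<lambda>_. 0) \<longleftrightarrow> P = []"
proof
  assume P: "is_tableau P" "sh P = (\<lambda>_. 0)"
  have "is_tableau []" "sh [] = (\<lambda>_. 0)" by (auto simp: is_tableau_def sh_def)
  then show "P = []" using sh_eq_imp_lengths[of P "[]"] P by simp
qed (auto simp: sh_def)

lemma sh_eq_single_box:
  assumes "is_tableau P" "sh P = sh [[x]]"
  obtains k where "P = [[k]]"
proof -
  have "is_tableau [[x]]" by (auto simp: is_tableau_def)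
  from sh_eq_imp_lengths[OF assms(1) this assms(2)] have "map length P = [1]" by simp
  then show ?thesis using that by (auto simp: map_eq_Cons_conv length_Suc_conv)
qed

text \<open>Serves to treat a one-letter word as an insertion into the empty tableau. All exponents
  vanish there, so \<open>ff\<close> is 1 in row 1 and the skipped rows contribute 1 - 0.\<close>

lemma kernel_empty:
  assumes "1 \<le> k" "k \<le> l" "1 \<le> k'" "k' \<le> l"
  shows "kernel q l k [] [[k']] = (if k = k' then 1 else 0)"
proof (cases "k = k'")
  case False
  then have "ty [[k']] \<noteq> add_unit (ty []) k"
    by (auto simp: ty_def add_unit_def fun_eq_iff)
  then show ?thesis using False by (simp add: kernel_def)
next
  case True
  \<comment> \<open>The box lies in row 1 at every level from \<open>k\<close> on; below
    \<open>k\<close> only the starting value \<open>k\<close> at index k - 1 matters.\<close>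
  define J where "J i = (if i < k then k else 1)" for i
  have s: "subsh [] i j = 0" "subsh [[k']] i j = (if k' \<le> i \<and> j = 1 then 1 else 0)" for i j
    by (auto simp: subsh_def subtab_def sh_def)
  have "is_path l k [] [[k']] J"
    using assms True unfolding is_path_def by (auto simp: J_def s add_unit_def fun_eq_iff)
  moreover have "ty [[k']] = add_unit (ty []) k"
    using True by (auto simp: ty_def add_unit_def fun_eq_iff)
  ultimately have "kernel q l k [] [[k']] = path_weight q l k [] J"
    by (intro kernel_eq)
  also have "\<dots> = 1"
    unfolding path_weight_def
  proof (rule prod.neutral, rule ballI)
    fix i assume "i \<in> {k..l}"
    then show "ff q k [] J i (J i) * (\<Prod>j=J i + 1..J (i - 1). 1 - ff q k [] J i j) = 1"
      using assms by (cases "i = k") (auto simp: J_def ff_def f0_def f1_def s intro!: prod.neutral)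
  qed
  finally show ?thesis using True by simp
qed

section \<open>Restrictions of standard tableaux\<close>

lemma concat_subtab: "concat (subtab i T) = filter (\<lambda>x. x \<le> i) (concat T)"
proof -
  have "concat (filter (\<lambda>r. r \<noteq> []) U) = concat U" for U :: "nat list list"
    by (induction U) auto
  then show ?thesis by (simp add: subtab_def filter_concat)
qed

lemma subtab_subtab:
  assumes "i \<le> k"
  shows "subtab i (subtab k T) = subtab i T"
proof -
  have "x \<le> k \<and> x \<le> i \<longleftrightarrow> x \<le> i" for x using assms by auto
  then show ?thesis
    unfolding subtab_def using assms by (induction T) (auto simp: filter_empty_conv)
qed

lemma distinct_set_singleton:
  assumes "distinct xs" "set xs = {x}"
  shows "xs = [x]"
  using assms by (cases xs; cases "tl xs") auto

lemma concat_singleton: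
  assumes "concat T = [x]" "[] \<notin> set T"
  shows "T = [[x]]"
proof (cases T)
  case (Cons r U)
  then have "r = [x]" "concat U = []"
    using assms by (auto simp: append_eq_Cons_conv)
  then show ?thesis using Cons assms(2) by (cases U) auto
qed (use assms in simp)

lemma subtab_one:
  assumes "Q \<in> standard_tableaux n" "1 \<le> n"
  shows "subtab 1 Q = [[1]]"
proof -
  have Q: "set (concat Q) = {1..n}" "distinct (concat Q)"
    using assms by (auto simp: standard_tableaux_def)
  let ?xs = "filter (\<lambda>x. x \<le> 1) (concat Q)"
  have "set ?xs = {1}" using Q(1) assms(2) by (auto simp del: set_concat)
  moreover have "distinct ?xs" using Q(2) by (rule distinct_filter)
  ultimately have xs: "concat (subtab 1 Q) = [1]"
    unfolding concat_subtab by (intro distinct_set_singleton)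
  have "[] \<notin> set (subtab 1 Q)" by (simp add: subtab_def)
  with xs show ?thesis by (rule concat_singleton)
qed

lemma count_list_distinct: "distinct xs \<Longrightarrow> count_list xs x = of_bool (x \<in> set xs)"
  by (induction xs) auto

text \<open>The letter m + 1 occurs exactly once, so exactly one row gains a box.\<close>

lemma subsh_standard_Suc:
  assumes "Q \<in> standard_tableaux n" "m < n"
  obtains j where "1 \<le> j" "subsh Q (Suc m) = add_unit (subsh Q m) j"
proof -
  have Q: "is_tableau Q" "set (concat Q) = {1..n}" "distinct (concat Q)"
    using assms by (auto simp: standard_tableaux_def)
  have "Suc m \<in> set (concat Q)" using Q(2) assms(2) by simp
  then obtain r where "r \<in> set Q" "Suc m \<in> set r" by auto
  then obtain i where i: "i < length Q" "Suc m \<in> set (Q ! i)" by (metis in_set_conv_nth)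
  have count: "count_list (row Q j) (Suc m) = of_bool (j = Suc i)" for j
  proof (cases "1 \<le> j \<and> j \<le> length Q")
    case True
    define k where "k = j - 1"
    have k: "k < length Q" "row Q j = Q ! k" "j = Suc i \<longleftrightarrow> k = i"
      using True by (auto simp: k_def row_def)
    have "distinct (Q ! k)"
      using Q(3) k(1) by (simp add: distinct_concat_iff)
    moreover have "Suc m \<notin> set (Q ! k)" if "k \<noteq> i"
    proof -
      \<comment> \<open>\<open>distinct_concat_iff\<close> gives distinctness of the nonempty rows
        only, and a tableau has no others.\<close>
      have "[] \<notin> set Q" using Q(1) by (simp add: is_tableau_def)
      then have "removeAll [] Q = Q" by (simp add: removeAll_id)
      then have "distinct Q" "\<And>ys zs. ys \<in> set Q \<Longrightarrow> zs \<in> set Q \<Longrightarrow> ys \<noteq> zs \<Longrightarrow> set ys \<inter> set zs = {}"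
        using Q(3) by (auto simp: distinct_concat_iff)
      moreover have "Q ! k \<noteq> Q ! i" using \<open>distinct Q\<close> k(1) i(1) that by (simp add: nth_eq_iff_index_eq)
      ultimately have "set (Q ! k) \<inter> set (Q ! i) = {}" using k(1) i(1) by simp
      then show ?thesis using i(2) by auto
    qed
    ultimately show ?thesis
      using i(2) k by (auto simp: count_list_0_iff count_list_distinct)
  next
    case False
    then show ?thesis using i by (auto simp: row_def)
  qed
  have "subsh Q (Suc m) = add_unit (subsh Q m) (Suc i)"
    by (rule ext) (auto simp: subsh_eq_length_filter[OF Q(1)] length_filter_Suc_count count add_unit_def)
  then show ?thesis using that[of "Suc i"] by simp
qed

lemma rho_Suc:
  assumes "1 \<le> j" "subsh Q (Suc m) = add_unit (subsh Q m) j"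
  shows "rho q (Suc m) Q = rho q m Q * (1 - q ^ (subsh Q (Suc m) j - subsh Q (Suc m) (j + 1)))"
proof -
  let ?I = "\<lambda>n. {(i, j). 1 \<le> i \<and> i \<le> n \<and> 1 \<le> j \<and> subsh Q i j = subsh Q (i - 1) j + 1}"
  have "?I (Suc m) = insert (Suc m, j) (?I m)"
    using assms by (auto simp: add_unit_def le_Suc_eq split: if_splits)
  moreover have "(Suc m, j) \<notin> ?I m" by simp
  ultimately show ?thesis
    unfolding rho_def using finite_rho_index[of m Q] by (simp add: mult.commute)
qed

section \<open>Induction on the length of the word\<close>

lemma sum_words_Suc:
  fixes F :: "nat list \<Rightarrow> 'a::comm_monoid_add"
  assumes "finite A"
  shows "(\<Sum>w | length w = Suc n \<and> set w \<subseteq> A. F w) =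
    (\<Sum>w | length w = n \<and> set w \<subseteq> A. \<Sum>k\<in>A. F (w @ [k]))"
proof -
  have "(\<Sum>w | length w = n \<and> set w \<subseteq> A. \<Sum>k\<in>A. F (w @ [k])) =
      (\<Sum>(w, k)\<in>{w. length w = n \<and> set w \<subseteq> A} \<times> A. F (w @ [k]))"
    by (rule sum.cartesian_product)
  also have "\<dots> = (\<Sum>w | length w = Suc n \<and> set w \<subseteq> A. F w)"
  proof (rule sum.reindex_bij_witness[of _ "\<lambda>w. (butlast w, last w)" "\<lambda>(w, k). w @ [k]"])
    fix w assume w: "w \<in> {w. length w = Suc n \<and> set w \<subseteq> A}"
    then have "w \<noteq> []" by auto
    then have e: "butlast w @ [last w] = w" "last w \<in> set w" by simp_all
    then show "(case (butlast w, last w) of (w, k) \<Rightarrow> w @ [k]) = w" by simp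
    show "(butlast w, last w) \<in> {w. length w = n \<and> set w \<subseteq> A} \<times> A"
      using w e(2) by (auto dest: in_set_butlastD)
  qed auto
  finally show ?thesis by simp
qed

text \<open>\<open>Q\<close> stays fixed and the induction runs over its restrictions, to which
  \<open>phi_snoc\<close> leads. Splitting off the last letter and exchanging sums leaves an
  instance of \<open>sum_kappa_kernel\<close>, whose new factor is the one that \<open>rho\<close>
  gains. The start is m = 1, as the empty word has weight 0.\<close>

lemma sum_phi_subtab:
  assumes q: "\<not> root_of_unity q" and Q: "Q \<in> standard_tableaux n"
    and "1 \<le> m" "m \<le> n" "P \<in> tableaux l" "sh P = subsh Q m"
  shows "(\<Sum>w | length w = m \<and> set w \<subseteq> {1..l}. phi q l w P (subtab m Q)) =
    inverse (qfac q (sh P l)) * kappa q l P * rho q m Q"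
  using assms(3-)
proof (induction m arbitrary: P rule: dec_induct)
  case base
  note Q1 = subtab_one[OF Q base(1)]
  have t: "is_tableau P" using base by (simp add: tableaux_def)
  have "sh P = sh [[1]]" using base(3) by (simp add: subsh_def Q1[simplified])
  then obtain k where k: "P = [[k]]" using sh_eq_single_box[OF t] by blast
  have kl: "1 \<le> k" "k \<le> l" using base(2) k by (auto simp: tableaux_def)
  have shP: "sh P = add_unit (\<lambda>_. 0) 1" by (auto simp: k sh_def add_unit_def fun_eq_iff)
  have Q0: "subsh Q 0 = (\<lambda>_. 0)"
  proof
    fix j
    have "Q \<in> tableaux n" using Q by (auto simp: standard_tableaux_def tableaux_def)
    from subsh_in_patterns[OF this] show "subsh Q 0 j = 0" by (simp add: patterns_def)
  qed
  have rho0: "rho q 0 Q = 1" unfolding rho_def by (rule prod.neutral) auto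
  have r: "rho q 1 Q = 1 - q ^ (sh P 1 - sh P (1 + 1))"
    using rho_Suc[of 1 Q 0 q] Q0 shP base(3) rho0 by simp
  have empty: "{P. P \<in> tableaux l \<and> sh P = (\<lambda>_. 0)} = {[]}"
    using sh_eq_zero_iff by (auto simp: tableaux_def is_tableau_def)
  have "(\<Sum>w | length w = 1 \<and> set w \<subseteq> {1..l}. phi q l w P (subtab 1 Q)) =
      (\<Sum>k'\<in>{1..l}. phi q l [k'] P [[1]])"
    unfolding Q1 by (rule sum.reindex_bij_witness[of _ "\<lambda>k. [k]" hd]) (auto simp: length_Suc_conv)
  also have "\<dots> = 1" using kl by (simp add: phi_single k)
  \<comment> \<open>The weight of a one-letter word contains no kernel; writing 1 as a sum of
    kernels from the empty tableau makes \<open>sum_kappa_kernel\<close> applicable.\<close>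
  also have "\<dots> = (\<Sum>k'=1..l. \<Sum>P0 | P0 \<in> tableaux l \<and> sh P0 = (\<lambda>_. 0).
            inverse (qfac q 0) * kappa q l P0 * kernel q l k' P0 P)"
  proof -
    have "kappa q l [] = 1"
      unfolding kappa_def by (simp add: subsh_def subtab_def sh_def qfac_def)
    moreover have "(\<Sum>k'=1..l. kernel q l k' [] P) = (\<Sum>k'=1..l. if k' = k then 1 else 0)"
      unfolding k using kl by (intro sum.cong refl) (simp add: kernel_empty)
    ultimately show ?thesis using kl unfolding empty by (simp add: qfac_def)
  qed
  also have "\<dots> = inverse (qfac q (sh P l)) * kappa q l P * (1 - q ^ (sh P 1 - sh P (1 + 1)))"
    by (rule sum_kappa_kernel[OF q base(2) shP order_refl])
  finally show ?case by (simp only: r)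
next
  case (step m)
  obtain j where j: "1 \<le> j" "subsh Q (Suc m) = add_unit (subsh Q m) j"
    using subsh_standard_Suc[OF Q, of m] step.prems(1) by auto
  let ?s = "subsh Q m"
  let ?W = "{w. length w = m \<and> set w \<subseteq> {1..l}}"
  have shP: "sh P = add_unit ?s j" using j step.prems(3) by simp
  have eq: "sh P = sh (subtab (Suc m) Q)" using step.prems(3) by (simp add: subsh_def)
  have "(\<Sum>w | length w = Suc m \<and> set w \<subseteq> {1..l}. phi q l w P (subtab (Suc m) Q)) =
      (\<Sum>w\<in>?W. \<Sum>k=1..l. phi q l (w @ [k]) P (subtab (Suc m) Q))"
    by (rule sum_words_Suc) simp
  also have "\<dots> = (\<Sum>w\<in>?W. \<Sum>k=1..l. \<Sum>P0 | P0 \<in> tableaux l \<and> sh P0 = ?s.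
      phi q l w P0 (subtab m Q) * kernel q l k P0 P)"
  proof (intro sum.cong refl)
    fix w k assume "w \<in> ?W"
    then have w: "w \<noteq> []" "length w = m" using step.hyps by auto
    show "phi q l (w @ [k]) P (subtab (Suc m) Q) =
      (\<Sum>P0 | P0 \<in> tableaux l \<and> sh P0 = ?s. phi q l w P0 (subtab m Q) * kernel q l k P0 P)"
      by (simp only: phi_snoc[OF w(1)] eq if_True refl w(2) subtab_subtab[OF le_SucI[OF order_refl]] subsh_def simp_thms)
  qed
  also have "\<dots> = (\<Sum>k=1..l. \<Sum>P0 | P0 \<in> tableaux l \<and> sh P0 = ?s. \<Sum>w\<in>?W.
      phi q l w P0 (subtab m Q) * kernel q l k P0 P)"
    by (subst sum.swap) (intro sum.cong refl sum.swap)
  also have "\<dots> = (\<Sum>k=1..l. \<Sum>P0 | P0 \<in> tableaux l \<and> sh P0 = ?s.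
      rho q m Q * (inverse (qfac q (?s l)) * kappa q l P0 * kernel q l k P0 P))"
  proof (intro sum.cong refl)
    fix k P0 assume "P0 \<in> {P0. P0 \<in> tableaux l \<and> sh P0 = ?s}"
    then have P0: "P0 \<in> tableaux l" "sh P0 = ?s" by auto
    show "(\<Sum>w\<in>?W. phi q l w P0 (subtab m Q) * kernel q l k P0 P) =
      rho q m Q * (inverse (qfac q (?s l)) * kappa q l P0 * kernel q l k P0 P)"
      unfolding sum_distrib_right[symmetric]
      using step.IH[OF _ P0] step.prems(1) P0(2) by simp
  qed
  also have "\<dots> = rho q m Q * (inverse (qfac q (sh P l)) * kappa q l P * (1 - q ^ (sh P j - sh P (j + 1))))"
    using sum_kappa_kernel[OF q step.prems(2) shP j(1)] by (simp only: sum_distrib_left[symmetric])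
  also have "\<dots> = inverse (qfac q (sh P l)) * kappa q l P * rho q (Suc m) Q"
    unfolding rho_Suc[OF j] step.prems(3)[symmetric] by (simp only: mult_ac)
  finally show ?case .
qed

theorem theorem2:
  fixes q :: complex and l n :: nat and P Q :: tableau and lam :: "nat \<Rightarrow> nat"
  assumes "l \<ge> 1" and "n \<ge> 1"
    and "\<not> root_of_unity q"
    and "P \<in> tableaux l" and "Q \<in> standard_tableaux n"
    and "sh P = lam" and "sh Q = lam"
  shows "(\<Sum>w | length w = n \<and> set w \<subseteq> {1..l}. phi q l w P Q) =
    inverse (qfac q (lam l)) * kappa q l P * rho q n Q"
proof -
  have "Q \<in> tableaux n" using assms(5) by (auto simp: standard_tableaux_def tableaux_def)
  have "filter (\<lambda>x. x \<le> n) r = r" if "r \<in> set Q" for r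
    using assms(5) that by (auto simp: standard_tableaux_def filter_id_conv)
  moreover have "[] \<notin> set Q" using assms(5) by (auto simp: standard_tableaux_def is_tableau_def)
  ultimately have "subtab n Q = Q"
    unfolding subtab_def by (simp add: map_idI) (auto simp: filter_id_conv)
  moreover have "sh P = subsh Q n"
    using subsh_top[OF \<open>Q \<in> tableaux n\<close> order_refl] assms(6,7) by simp
  ultimately show ?thesis
    using sum_phi_subtab[OF assms(3,5,2) order_refl assms(4)] assms(6) by simp
qed

end
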